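(* Let $\mathcal V$ be a completely distributive commutative quantale such that the tensor laxly preserves the totally-below relation. Let $T:\mathsf{Set}\to\mathsf{Set}$ be a functor which preserves weak pullbacks. Then post-composition with the relation lifting $\mathsf{Rel}_T:\mathsf{Rel}\to\mathsf{Rel}$ yields a functor $$\mathsf{Rel}_T\circ(-):\mathsf{RelPresh}_c\to\mathsf{RelPresh}$$ such that the diagram consisting of the top row $$\mathsf{RelPresh}_c\xrightarrow{\ \mathsf{Rel}_T\circ(-)\ }\mathsf{RelPresh}\xrightarrow{\ \mathcal C\ }\mathsf{RelPresh}_c,$$ the bottom row $\mathsf{Set}\xrightarrow{\ T\ }\mathsf{Set}\xrightarrow{\ \mathrm{Id}\ }\mathsf{Set}$, and the three vertical discrete functors $D:\mathsf{Set}\to\mathsf{RelPresh}_c$, $D:\mathsf{Set}\to\mathsf{RelPresh}$, $D:\mathsf{Set}\to\mathsf{RelPresh}_c$ commutes. Moreover, the composite $\mathcal C\circ(\mathsf{Rel}_T\circ(-))$ in the upper row is the $\mathcal V\text{-}\mathsf{cat}$-ification of $T$ (under the equivalence $\Phi:(\mathcal V\text{-}\mathsf{cat})_o\simeq\mathsf{RelPresh}_c$).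
   Context: $\mathcal V=(\mathcal V_o,\otimes,e,[-,-])$ is a commutative quantale: a complete lattice with a commutative, associative, monotone operation $\otimes$ with unit $e$, such that each $-\otimes r$ has a right adjoint $[r,-]$; $\mathcal V$ is assumed non-trivial ($e\neq\bot$). $\mathcal V$ is completely distributive if $\mathfrak D\mapsto\bigvee\mathfrak D$, from downsets of $\mathcal V$ to $\mathcal V$, has a left adjoint; this left adjoint is $r\mapsto\{s\mid s\ll r\}$, where the totally-below relation is: $s\ll r$ iff for every downset $\mathfrak D\subseteq\mathcal V$, $r\le\bigvee\mathfrak D$ implies $s\in\mathfrak D$. The tensor laxly preserves $\ll$ if $r\ll s$ and $r'\ll s'$ imply $r\otimes r'\ll s\otimes s'$. A (small) $\mathcal V$-category $\mathcal X$ is a set of objects together with elements $\mathcal X(x',x)\in\mathcal V_o$ satisfying $e\le\mathcal X(x,x)$ and $\mathcal X(x',x)\otimes\mathcal X(x'',x')\le\mathcal X(x'',x)$; a $\mathcal V$-functor $f:\mathcal X\to\mathcal Y$ is a map on objects with $\mathcal X(x',x)\le\mathcal Y(fx',fx)$. $(\mathcal V\text{-}\mathsf{cat})_o$ is the ordinary category of small $\mathcal V$-categories and $\mathcal V$-functors; $\mathcal V\text{-}\mathsf{cat}$ denotes it enriched over itself, with hom $[\mathcal Y,\mathcal Z](f,g)=\bigwedge_y\mathcal Z(fy,gy)$. $\mathsf{Rel}$ is the 2-category of sets and relations ordered by inclusion; $f_\diamond$ is the graph of a function $f$. A relational presheaf $\mathfrak X$ (a lax 2-functor $(\Sigma\mathcal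 V)^{\mathsf{coop}}\to\mathsf{Rel}$, where $\Sigma\mathcal V$ is the one-object ordered category with hom $\mathcal V_o$ and composition $\otimes$) consists of a set $X=\mathfrak X( * )$ and relations $\mathfrak X(r)\subseteq X\times X$, $r\in\mathcal V_o$, with $\mathrm{Id}_X\subseteq\mathfrak X(e)$, $\mathfrak X(r)\cdot\mathfrak X(s)\subseteq\mathfrak X(r\otimes s)$, and $\mathfrak X(r)\subseteq\mathfrak X(s)$ whenever $r\ge s$. A morphism $\mathfrak X\to\mathfrak Y$ is a map $f:\mathfrak X( * )\to\mathfrak Y( * )$ with $f_\diamond\cdot\mathfrak X(r)\subseteq\mathfrak Y(r)\cdot f_\diamond$ for all $r$, i.e. $(x',x)\in\mathfrak X(r)$ implies $(fx',fx)\in\mathfrak Y(r)$. This gives the category $\mathsf{RelPresh}$. $\mathfrak X$ is continuous if $\mathfrak X(\bigvee_ir_i)\supseteq\bigcap_i\mathfrak X(r_i)$ for all families $(r_i)_{i\in I}$; $\mathsf{RelPresh}_c$ is the full subcategory of continuous presheaves. The functor $\Phi:(\mathcal V\text{-}\mathsf{cat})_o\to\mathsf{RelPresh}_c$, with $\Phi(\mathcal X)( * )=X_{\mathsf o}$ (the set of objects of $\mathcal X$) and $\Phi(\mathcal X)(r)=X_r=\{(x',x)\mid r\le\mathcal X(x',x)\}$, is an equivalence of categories. The functors $D$ from $\mathsf{Set}$ send $X$ to the presheaf $\Phi(DX)$ of the discrete $\mathcal V$-category $DX$ on $X$ (distance $e$ between equal objects, $\bot$ otherwise). Closure: for a relational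 presheaf $F$, $\mathcal CF( * )=F( * )$ and $\mathcal CF(r)=\bigcap\{F(s)\mid s\ll r\}$; this gives a functor $\mathcal C:\mathsf{RelPresh}\to\mathsf{RelPresh}_c$. Relation lifting: for a relation $R\subseteq X\times Y$ with projections $p,q$, $\mathsf{Rel}_T(R)=\{(Tp(C),Tq(C))\mid C\in TR\}\subseteq TX\times TY$; $(\mathsf{Rel}_T\circ\mathfrak X)( * )=T(\mathfrak X( * ))$ and $(\mathsf{Rel}_T\circ\mathfrak X)(r)=\mathsf{Rel}_T(\mathfrak X(r))$. The $\mathcal V\text{-}\mathsf{cat}$-ification of $T$ is the $\mathcal V\text{-}\mathsf{cat}$-enriched left Kan extension $T_{\mathcal V}=\mathrm{Lan}_D(DT)$ of $DT$ along $D:\mathsf{Set}\to\mathcal V\text{-}\mathsf{cat}$, where $\mathsf{Set}$ is $\mathcal V\text{-}\mathsf{cat}$-enriched with discrete homs.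
   Formalization: Commutation involving T fails in general, so exact criteria replace it: the left square commutes iff T1 has at most one element and (e = ⊤ or T∅ = ∅); the outer rectangle commutes iff e = ⊤ or T∅ = ∅. The right square and the V-cat-ification claim hold unconditionally. *)

theory Defs
  imports "HOL-Library.FuncSet" "HOL-Library.Nat_Bijection"
begin

section \<open>Quantales\<close>

text \<open>The underlying complete lattice is the type.\<close>

record 'v quantale =
  tensor :: "'v \<Rightarrow> 'v \<Rightarrow> 'v"  (infixl \<open>\<otimes>\<index>\<close> 70)
  qunit :: 'v  (\<open>\<e>\<index>\<close>)
  ihom :: "'v \<Rightarrow> 'v \<Rightarrow> 'v"

locale comm_quantale =
  fixes V :: "'v::complete_lattice quantale" (structure)
  assumes tensor_commute: "r \<otimes> s = s \<otimes> r"
    and tensor_assoc: "(r \<otimes> s) \<otimes> t = r \<otimes> (s \<otimes> t)"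
    and tensor_unit: "\<e> \<otimes> r = r"
    and tensor_mono: "r \<le> r' \<Longrightarrow> s \<le> s' \<Longrightarrow> r \<otimes> s \<le> r' \<otimes> s'"
    and ihom_adjoint: "s \<otimes> r \<le> t \<longleftrightarrow> s \<le> ihom V r t"
    and nontrivial: "\<e> \<noteq> bot"

definition downset :: "'v::order set \<Rightarrow> bool" where
  "downset D \<longleftrightarrow> (\<forall>r\<in>D. \<forall>s. s \<le> r \<longrightarrow> s \<in> D)"

text \<open>The supremum map from downsets (ordered by inclusion) has a left adjoint.\<close>

definition completely_distributive :: "'v::complete_lattice itself \<Rightarrow> bool" where
  "completely_distributive _ \<longleftrightarrow>
     (\<exists>L :: 'v \<Rightarrow> 'v set. (\<forall>r. downset (L r)) \<and>
        (\<forall>r D. downset D \<longrightarrow> (L r \<subseteq> D \<longleftrightarrow> r \<le> Sup D)))"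

definition totally_below :: "'v::complete_lattice \<Rightarrow> 'v \<Rightarrow> bool"  (infix \<open>\<lless>\<close> 50) where
  "s \<lless> r \<longleftrightarrow> (\<forall>D. downset D \<longrightarrow> r \<le> Sup D \<longrightarrow> s \<in> D)"

definition tensor_laxly_preserves_totally_below :: "'v::complete_lattice quantale \<Rightarrow> bool" where
  "tensor_laxly_preserves_totally_below V \<longleftrightarrow>
     (\<forall>r s r' s'. r \<lless> s \<longrightarrow> r' \<lless> s' \<longrightarrow> r \<otimes>\<^bsub>V\<^esub> r' \<lless> s \<otimes>\<^bsub>V\<^esub> s')"


section \<open>Categories and functors\<close>

text \<open>
  The composite of \<open>f : A \<rightarrow> B\<close> and \<open>g : B \<rightarrow> C\<close> is \<open>Cmp A B C g f\<close>. A functor acts on a morphism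
  together with its source and target: morphisms will be functions, from which the target cannot
  be recovered.
\<close>

record ('o, 'm) cat =
  Ob :: "'o set"
  Mor :: "'o \<Rightarrow> 'o \<Rightarrow> 'm set"
  Idm :: "'o \<Rightarrow> 'm"
  Cmp :: "'o \<Rightarrow> 'o \<Rightarrow> 'o \<Rightarrow> 'm \<Rightarrow> 'm \<Rightarrow> 'm"

record ('o, 'm, 'p, 'n) ftr =
  fo :: "'o \<Rightarrow> 'p"
  fm :: "'o \<Rightarrow> 'o \<Rightarrow> 'm \<Rightarrow> 'n"

definition is_functor :: "('o, 'm) cat \<Rightarrow> ('p, 'n) cat \<Rightarrow> ('o, 'm, 'p, 'n) ftr \<Rightarrow> bool" where
  "is_functor C D F \<longleftrightarrow>
     (\<forall>a\<in>Ob C. fo F a \<in> Ob D) \<and>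
     (\<forall>a\<in>Ob C. \<forall>b\<in>Ob C. \<forall>f\<in>Mor C a b. fm F a b f \<in> Mor D (fo F a) (fo F b)) \<and>
     (\<forall>a\<in>Ob C. fm F a a (Idm C a) = Idm D (fo F a)) \<and>
     (\<forall>a\<in>Ob C. \<forall>b\<in>Ob C. \<forall>c\<in>Ob C. \<forall>f\<in>Mor C a b. \<forall>g\<in>Mor C b c.
        fm F a c (Cmp C a b c g f) =
          Cmp D (fo F a) (fo F b) (fo F c) (fm F b c g) (fm F a b f))"

definition functor_comp ::
  "('p, 'n, 'q, 'k) ftr \<Rightarrow> ('o, 'm, 'p, 'n) ftr \<Rightarrow> ('o, 'm, 'q, 'k) ftr"  (infixl \<open>\<circ>\<^sub>F\<close> 55) where
  "G \<circ>\<^sub>F F = \<lparr>fo = (\<lambda>a. fo G (fo F a)),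
              fm = (\<lambda>a b f. fm G (fo F a) (fo F b) (fm F a b f))\<rparr>"

definition functor_eq ::
  "('o, 'm) cat \<Rightarrow> ('o, 'm, 'p, 'n) ftr \<Rightarrow> ('o, 'm, 'p, 'n) ftr \<Rightarrow> bool" where
  "functor_eq C F G \<longleftrightarrow>
     (\<forall>a\<in>Ob C. fo F a = fo G a) \<and>
     (\<forall>a\<in>Ob C. \<forall>b\<in>Ob C. \<forall>f\<in>Mor C a b. fm F a b f = fm G a b f)"

definition nat_trans ::
  "('o, 'm) cat \<Rightarrow> ('p, 'n) cat \<Rightarrow> ('o, 'm, 'p, 'n) ftr \<Rightarrow> ('o, 'm, 'p, 'n) ftr
     \<Rightarrow> ('o \<Rightarrow> 'n) \<Rightarrow> bool" where
  "nat_trans C D F G \<alpha> \<longleftrightarrow>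
     (\<forall>a\<in>Ob C. \<alpha> a \<in> Mor D (fo F a) (fo G a)) \<and>
     (\<forall>a\<in>Ob C. \<forall>b\<in>Ob C. \<forall>f\<in>Mor C a b.
        Cmp D (fo F a) (fo F b) (fo G b) (\<alpha> b) (fm F a b f) =
        Cmp D (fo F a) (fo G a) (fo G b) (fm G a b f) (\<alpha> a))"

text \<open>The square with projections \<open>p : P \<rightarrow> A\<close>, \<open>q : P \<rightarrow> B\<close> over the cospan
  \<open>f : A \<rightarrow> Z\<close>, \<open>g : B \<rightarrow> Z\<close>.\<close>

definition weak_pullback ::
  "('o, 'm) cat \<Rightarrow> 'o \<Rightarrow> 'o \<Rightarrow> 'o \<Rightarrow> 'o \<Rightarrow> 'm \<Rightarrow> 'm \<Rightarrow> 'm \<Rightarrow> 'm \<Rightarrow> bool" where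
  "weak_pullback C P A B Z p q f g \<longleftrightarrow>
     P \<in> Ob C \<and> A \<in> Ob C \<and> B \<in> Ob C \<and> Z \<in> Ob C \<and>
     p \<in> Mor C P A \<and> q \<in> Mor C P B \<and> f \<in> Mor C A Z \<and> g \<in> Mor C B Z \<and>
     Cmp C P A Z f p = Cmp C P B Z g q \<and>
     (\<forall>Q\<in>Ob C. \<forall>u\<in>Mor C Q A. \<forall>v\<in>Mor C Q B. Cmp C Q A Z f u = Cmp C Q B Z g v \<longrightarrow>
        (\<exists>w\<in>Mor C Q P. Cmp C Q P A p w = u \<and> Cmp C Q P B q w = v))"

definition preserves_weak_pullbacks ::
  "('o, 'm) cat \<Rightarrow> ('p, 'n) cat \<Rightarrow> ('o, 'm, 'p, 'n) ftr \<Rightarrow> bool" where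
  "preserves_weak_pullbacks C D F \<longleftrightarrow>
     (\<forall>P A B Z p q f g. weak_pullback C P A B Z p q f g \<longrightarrow>
        weak_pullback D (fo F P) (fo F A) (fo F B) (fo F Z)
          (fm F P A p) (fm F P B q) (fm F A Z f) (fm F B Z g))"


section \<open>The category of sets\<close>

text \<open>
  Small sets are the members of a Grothendieck universe, here a collection of sets of elements of
  an ambient type. Because a set is not itself an element of that type, ordered pairs are given by
  an injective pairing operation and power sets up to a bijection. Replacement and products follow
  from singletons and unions. An infinite small set is not required, so that the finite subsets
  of a countable type form a universe as well.
\<close>

record 'a universe =
  small_sets :: "'a set set"
  pair :: "'a \<times> 'a \<Rightarrow> 'a"

locale set_universe =
  fixes U :: "'a universe"
  assumes pair_inj: "inj (pair U)"
    and small_singleton: "{x} \<in> small_sets U"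
    and small_subset: "A \<in> small_sets U \<Longrightarrow> B \<subseteq> A \<Longrightarrow> B \<in> small_sets U"
    and small_UN: "A \<in> small_sets U \<Longrightarrow> (\<And>x. x \<in> A \<Longrightarrow> G x \<in> small_sets U)
                   \<Longrightarrow> (\<Union>x\<in>A. G x) \<in> small_sets U"
    and small_Pow: "A \<in> small_sets U \<Longrightarrow> \<exists>h. inj_on h (Pow A) \<and> h ` Pow A \<in> small_sets U"

lemma set_universe_finite_nat:
  "set_universe \<lparr>small_sets = {A :: nat set. finite A}, pair = prod_encode\<rparr>"
proof
  fix A :: "nat set"
  assume "A \<in> small_sets \<lparr>small_sets = {A. finite A}, pair = prod_encode\<rparr>"
  then have "finite (Pow A)" by simp
  then obtain h :: "nat set \<Rightarrow> nat" where "inj_on h (Pow A)"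
    by (metis finite_imp_inj_to_nat_seg)
  with \<open>finite (Pow A)\<close> show "\<exists>h. inj_on h (Pow A) \<and>
      h ` Pow A \<in> small_sets \<lparr>small_sets = {A :: nat set. finite A}, pair = prod_encode\<rparr>"
    by (intro exI[of _ h]) simp
qed (auto simp: inj_prod_encode intro: finite_subset)

definition Set_cat :: "'a universe \<Rightarrow> ('a set, 'a \<Rightarrow> 'a) cat" where
  "Set_cat U = \<lparr>Ob = small_sets U,
                Mor = (\<lambda>A B. A \<rightarrow>\<^sub>E B),
                Idm = (\<lambda>A. \<lambda>x\<in>A. x),
                Cmp = (\<lambda>A B C g f. compose A g f)\<rparr>"


section \<open>V-categories\<close>

record ('a, 'v) vcat =
  obj :: "'a set"
  dist :: "'a \<Rightarrow> 'a \<Rightarrow> 'v"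

text \<open>Distances involving non-objects are normalised to bottom, so that a V-category is
  determined by its objects and the distances between them.\<close>

definition is_vcat :: "'v::complete_lattice quantale \<Rightarrow> ('a, 'v) vcat \<Rightarrow> bool" where
  "is_vcat V X \<longleftrightarrow>
     (\<forall>x\<in>obj X. \<e>\<^bsub>V\<^esub> \<le> dist X x x) \<and>
     (\<forall>x\<in>obj X. \<forall>x'\<in>obj X. \<forall>x''\<in>obj X.
        dist X x' x \<otimes>\<^bsub>V\<^esub> dist X x'' x' \<le> dist X x'' x) \<and>
     (\<forall>x x'. x \<notin> obj X \<or> x' \<notin> obj X \<longrightarrow> dist X x' x = bot)"

definition is_vfunctor :: "('a, 'v::complete_lattice) vcat \<Rightarrow> ('b, 'v) vcat \<Rightarrow> ('a \<Rightarrow> 'b) \<Rightarrow> bool" where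
  "is_vfunctor X Y f \<longleftrightarrow> f \<in> obj X \<rightarrow>\<^sub>E obj Y \<and>
     (\<forall>x'\<in>obj X. \<forall>x\<in>obj X. dist X x' x \<le> dist Y (f x') (f x))"

definition vhom :: "('a, 'v::complete_lattice) vcat \<Rightarrow> ('b, 'v) vcat \<Rightarrow> ('a \<Rightarrow> 'b, 'v) vcat" where
  "vhom Y Z = \<lparr>obj = {f. is_vfunctor Y Z f},
               dist = (\<lambda>f g. if is_vfunctor Y Z f \<and> is_vfunctor Y Z g
                             then (INF y\<in>obj Y. dist Z (f y) (g y)) else bot)\<rparr>"

definition discrete :: "'v::complete_lattice quantale \<Rightarrow> 'a set \<Rightarrow> ('a, 'v) vcat" where
  "discrete V A = \<lparr>obj = A, dist = (\<lambda>x y. if x \<in> A \<and> x = y then \<e>\<^bsub>V\<^esub> else bot)\<rparr>"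

text \<open>Isomorphisms of V-categories.\<close>

definition is_viso :: "('a, 'v::complete_lattice) vcat \<Rightarrow> ('b, 'v) vcat \<Rightarrow> ('a \<Rightarrow> 'b) \<Rightarrow> bool" where
  "is_viso X Y f \<longleftrightarrow> bij_betw f (obj X) (obj Y) \<and>
     (\<forall>x'\<in>obj X. \<forall>x\<in>obj X. dist Y (f x') (f x) = dist X x' x)"


section \<open>Enrichment over V-cat and Kan extensions\<close>

text \<open>Categories whose homs are V-categories, and their underlying ordinary categories.\<close>

record ('o, 'm, 'v) ecat =
  EOb :: "'o set"
  EHom :: "'o \<Rightarrow> 'o \<Rightarrow> ('m, 'v) vcat"
  EId :: "'o \<Rightarrow> 'm"
  ECmp :: "'o \<Rightarrow> 'o \<Rightarrow> 'o \<Rightarrow> 'm \<Rightarrow> 'm \<Rightarrow> 'm"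

definition underlying :: "('o, 'm, 'v) ecat \<Rightarrow> ('o, 'm) cat" where
  "underlying A = \<lparr>Ob = EOb A, Mor = (\<lambda>a b. obj (EHom A a b)), Idm = EId A, Cmp = ECmp A\<rparr>"

definition SetE :: "'v::complete_lattice quantale \<Rightarrow> 'a universe \<Rightarrow> ('a set, 'a \<Rightarrow> 'a, 'v) ecat" where
  "SetE V U = \<lparr>EOb = Ob (Set_cat U),
               EHom = (\<lambda>A B. discrete V (Mor (Set_cat U) A B)),
               EId = Idm (Set_cat U),
               ECmp = Cmp (Set_cat U)\<rparr>"

definition VCat ::
  "'v::complete_lattice quantale \<Rightarrow> 'a universe \<Rightarrow> (('a, 'v) vcat, 'a \<Rightarrow> 'a, 'v) ecat" where
  "VCat V U = \<lparr>EOb = {X. is_vcat V X \<and> obj X \<in> small_sets U},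
               EHom = vhom,
               EId = (\<lambda>X. \<lambda>x\<in>obj X. x),
               ECmp = (\<lambda>X Y Z g f. compose (obj X) g f)\<rparr>"

text \<open>
  Two V-functors are equal iff they agree on objects, so an enriched natural transformation is just
  a natural transformation between the underlying functors.
\<close>

definition is_efunctor ::
  "('o, 'm, 'v::complete_lattice) ecat \<Rightarrow> ('p, 'n, 'v) ecat \<Rightarrow> ('o, 'm, 'p, 'n) ftr \<Rightarrow> bool" where
  "is_efunctor A B F \<longleftrightarrow> is_functor (underlying A) (underlying B) F \<and>
     (\<forall>a\<in>EOb A. \<forall>b\<in>EOb A.
        is_vfunctor (EHom A a b) (EHom B (fo F a) (fo F b))
          (restrict (fm F a b) (obj (EHom A a b))))"

text \<open>
  For enriched presheaves \<open>P, Q : A\<^sup>o\<^sup>p \<rightarrow> V-cat\<close>, the hom \<open>[A\<^sup>o\<^sup>p, V-cat](P, Q)\<close>, that is, the end of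
  the V-categories \<open>[P a, Q a]\<close>. The action of a presheaf on \<open>h : a \<rightarrow> b\<close> is
  \<open>fm P a b h : P b \<rightarrow> P a\<close>.
\<close>

definition psh_trans ::
  "('o, 'm, 'v::complete_lattice) ecat \<Rightarrow> ('o, 'm, ('p, 'v) vcat, 'p \<Rightarrow> 'p) ftr
     \<Rightarrow> ('o, 'm, ('q, 'v) vcat, 'q \<Rightarrow> 'q) ftr \<Rightarrow> ('o \<Rightarrow> 'p \<Rightarrow> 'q) set" where
  "psh_trans A P Q =
     {\<phi> \<in> (\<Pi>\<^sub>E a\<in>EOb A. obj (vhom (fo P a) (fo Q a))).
        \<forall>a\<in>EOb A. \<forall>b\<in>EOb A. \<forall>h\<in>obj (EHom A a b). \<forall>x\<in>obj (fo P b).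
          \<phi> a (fm P a b h x) = fm Q a b h (\<phi> b x)}"

definition psh_hom ::
  "('o, 'm, 'v::complete_lattice) ecat \<Rightarrow> ('o, 'm, ('p, 'v) vcat, 'p \<Rightarrow> 'p) ftr
     \<Rightarrow> ('o, 'm, ('q, 'v) vcat, 'q \<Rightarrow> 'q) ftr \<Rightarrow> ('o \<Rightarrow> 'p \<Rightarrow> 'q, 'v) vcat" where
  "psh_hom A P Q =
     \<lparr>obj = psh_trans A P Q,
      dist = (\<lambda>\<phi> \<psi>. if \<phi> \<in> psh_trans A P Q \<and> \<psi> \<in> psh_trans A P Q
                    then (INF a\<in>EOb A. dist (vhom (fo P a) (fo Q a)) (\<phi> a) (\<psi> a)) else bot)\<rparr>"

text \<open>The presheaf \<open>B(F -, b)\<close>.\<close>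

definition rep ::
  "('p, 'n, 'v) ecat \<Rightarrow> ('o, 'm, 'p, 'n) ftr \<Rightarrow> 'p \<Rightarrow> ('o, 'm, ('n, 'v) vcat, 'n \<Rightarrow> 'n) ftr" where
  "rep B F b =
     \<lparr>fo = (\<lambda>a. EHom B (fo F a) b),
      fm = (\<lambda>a a' h. \<lambda>k\<in>obj (EHom B (fo F a') b). ECmp B (fo F a) (fo F a') b k (fm F a a' h))\<rparr>"

text \<open>
  \<open>\<alpha> : F \<Rightarrow> L K\<close> exhibits \<open>L : C \<rightarrow> B\<close> as the enriched left Kan extension of \<open>F : A \<rightarrow> B\<close> along
  \<open>K : A \<rightarrow> C\<close> (in Kelly's sense: \<open>L c\<close> is the colimit of \<open>F\<close> weighted by \<open>C(K -, c)\<close>): the map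
  \<open>B(L c, b) \<rightarrow> [A\<^sup>o\<^sup>p, V-cat](C(K -, c), B(F -, b))\<close> sending \<open>g\<close> to the transformation
  \<open>k \<mapsto> g \<cdot> L k \<cdot> \<alpha>\<^sub>a\<close> is an isomorphism of V-categories.
\<close>

definition is_left_kan_ext ::
  "('o, 'm, 'v::complete_lattice) ecat \<Rightarrow> ('q, 'k, 'v) ecat \<Rightarrow> ('p, 'n, 'v) ecat
     \<Rightarrow> ('o, 'm, 'q, 'k) ftr \<Rightarrow> ('o, 'm, 'p, 'n) ftr \<Rightarrow> ('q, 'k, 'p, 'n) ftr \<Rightarrow> ('o \<Rightarrow> 'n) \<Rightarrow> bool" where
  "is_left_kan_ext A C B K F L \<alpha> \<longleftrightarrow>
     is_efunctor A C K \<and> is_efunctor A B F \<and> is_efunctor C B L \<and>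
     nat_trans (underlying A) (underlying B) F (L \<circ>\<^sub>F K) \<alpha> \<and>
     (\<forall>c\<in>EOb C. \<forall>b\<in>EOb B.
        is_viso (EHom B (fo L c) b) (psh_hom A (rep C K c) (rep B F b))
          (\<lambda>g. \<lambda>a\<in>EOb A. \<lambda>k\<in>obj (EHom C (fo K a) c).
             ECmp B (fo F a) (fo L c) b g
               (ECmp B (fo F a) (fo L (fo K a)) (fo L c) (fm L (fo K a) c k) (\<alpha> a))))"


section \<open>Relational presheaves\<close>

record ('a, 'v) rpresh =
  carrier :: "'a set"
  rel :: "'v \<Rightarrow> ('a \<times> 'a) set"

text \<open>Relations compose in functional order: \<open>\<XX>(r) \<cdot> \<XX>(s)\<close> is \<open>rel F s O rel F r\<close>.\<close>

definition is_rpresh :: "'v::complete_lattice quantale \<Rightarrow> ('a, 'v) rpresh \<Rightarrow> bool" where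
  "is_rpresh V F \<longleftrightarrow>
     (\<forall>r. rel F r \<subseteq> carrier F \<times> carrier F) \<and>
     Id_on (carrier F) \<subseteq> rel F \<e>\<^bsub>V\<^esub> \<and>
     (\<forall>r s. rel F s O rel F r \<subseteq> rel F (r \<otimes>\<^bsub>V\<^esub> s)) \<and>
     (\<forall>r s. s \<le> r \<longrightarrow> rel F r \<subseteq> rel F s)"

text \<open>The intersection of the empty family is the total relation on the carrier.\<close>

definition continuous_rpresh :: "('a, 'v::complete_lattice) rpresh \<Rightarrow> bool" where
  "continuous_rpresh F \<longleftrightarrow>
     (\<forall>S. (carrier F \<times> carrier F) \<inter> (\<Inter>r\<in>S. rel F r) \<subseteq> rel F (Sup S))"

definition rpresh_mor :: "('a, 'v) rpresh \<Rightarrow> ('a, 'v) rpresh \<Rightarrow> ('a \<Rightarrow> 'a) set" where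
  "rpresh_mor F G = {f \<in> carrier F \<rightarrow>\<^sub>E carrier G.
                       \<forall>r x' x. (x', x) \<in> rel F r \<longrightarrow> (f x', f x) \<in> rel G r}"

definition RelPresh ::
  "'v::complete_lattice quantale \<Rightarrow> 'a universe \<Rightarrow> (('a, 'v) rpresh, 'a \<Rightarrow> 'a) cat" where
  "RelPresh V U = \<lparr>Ob = {F. is_rpresh V F \<and> carrier F \<in> small_sets U},
                   Mor = rpresh_mor,
                   Idm = (\<lambda>F. \<lambda>x\<in>carrier F. x),
                   Cmp = (\<lambda>F G H g f. compose (carrier F) g f)\<rparr>"

definition RelPresh\<^sub>c ::
  "'v::complete_lattice quantale \<Rightarrow> 'a universe \<Rightarrow> (('a, 'v) rpresh, 'a \<Rightarrow> 'a) cat" where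
  "RelPresh\<^sub>c V U = (RelPresh V U)\<lparr>Ob := {F \<in> Ob (RelPresh V U). continuous_rpresh F}\<rparr>"

text \<open>On morphisms, the functors \<open>\<Phi>\<close>, \<open>Disc\<close> and \<open>Closure\<close> do not change the function.\<close>

definition \<Phi> :: "(('a, 'v::complete_lattice) vcat, 'a \<Rightarrow> 'a, ('a, 'v) rpresh, 'a \<Rightarrow> 'a) ftr" where
  "\<Phi> = \<lparr>fo = (\<lambda>X. \<lparr>carrier = obj X,
                   rel = (\<lambda>r. {(x', x). x' \<in> obj X \<and> x \<in> obj X \<and> r \<le> dist X x' x})\<rparr>),
        fm = (\<lambda>_ _ f. f)\<rparr>"

definition Disc ::
  "'v::complete_lattice quantale \<Rightarrow> ('a set, 'a \<Rightarrow> 'a, ('a, 'v) vcat, 'a \<Rightarrow> 'a) ftr" where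
  "Disc V = \<lparr>fo = discrete V, fm = (\<lambda>_ _ f. f)\<rparr>"

text \<open>The functor from sets to relational presheaves, whether continuous or not.\<close>

definition DiscR ::
  "'v::complete_lattice quantale \<Rightarrow> ('a set, 'a \<Rightarrow> 'a, ('a, 'v) rpresh, 'a \<Rightarrow> 'a) ftr" where
  "DiscR V = \<Phi> \<circ>\<^sub>F Disc V"

definition Closure ::
  "(('a, 'v::complete_lattice) rpresh, 'a \<Rightarrow> 'a, ('a, 'v) rpresh, 'a \<Rightarrow> 'a) ftr" where
  "Closure = \<lparr>fo = (\<lambda>F. \<lparr>carrier = carrier F,
                         rel = (\<lambda>r. (carrier F \<times> carrier F) \<inter> (\<Inter>s\<in>{s. s \<lless> r}. rel F s))\<rparr>),
              fm = (\<lambda>_ _ f. f)\<rparr>"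


section \<open>Relation lifting\<close>

type_synonym 'a set_functor = "('a set, 'a \<Rightarrow> 'a, 'a set, 'a \<Rightarrow> 'a) ftr"

text \<open>A relation \<open>R \<subseteq> X \<times> Y\<close> as an object of the category of sets.\<close>

definition rel_obj :: "'a universe \<Rightarrow> ('a \<times> 'a) set \<Rightarrow> 'a set" where
  "rel_obj U R = pair U ` R"

definition rel_fst :: "'a universe \<Rightarrow> ('a \<times> 'a) set \<Rightarrow> 'a \<Rightarrow> 'a" where
  "rel_fst U R = (\<lambda>u\<in>rel_obj U R. fst (inv (pair U) u))"

definition rel_snd :: "'a universe \<Rightarrow> ('a \<times> 'a) set \<Rightarrow> 'a \<Rightarrow> 'a" where
  "rel_snd U R = (\<lambda>u\<in>rel_obj U R. snd (inv (pair U) u))"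

definition rel_lift ::
  "'a universe \<Rightarrow> 'a set_functor \<Rightarrow> 'a set \<Rightarrow> 'a set \<Rightarrow> ('a \<times> 'a) set \<Rightarrow> ('a \<times> 'a) set" where
  "rel_lift U T X Y R =
     (\<lambda>C. (fm T (rel_obj U R) X (rel_fst U R) C, fm T (rel_obj U R) Y (rel_snd U R) C))
       ` fo T (rel_obj U R)"

text \<open>Post-composition of relational presheaves with the relation lifting.\<close>

definition RelLift ::
  "'a universe \<Rightarrow> 'a set_functor
     \<Rightarrow> (('a, 'v) rpresh, 'a \<Rightarrow> 'a, ('a, 'v) rpresh, 'a \<Rightarrow> 'a) ftr" where
  "RelLift U T =
     \<lparr>fo = (\<lambda>F. \<lparr>carrier = fo T (carrier F),
                rel = (\<lambda>r. rel_lift U T (carrier F) (carrier F) (rel F r))\<rparr>),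
      fm = (\<lambda>F G f. fm T (carrier F) (carrier G) f)\<rparr>"

end

(* A map g : T X -> Y out of a discrete V-category underlies a transformation
   [DA, X] -> [DTA, Y], natural in A, by k |-> g . T k, and by the Yoneda lemma every
   such natural family of functions is of this form. The family consists of V-functors iff,
   whenever r is below the distance from h to k for h, k : A -> X, also r <= Y(g (T h c), g (T k c))
   for all c in T A. Taking for A the relation X_r with its projections shows that this
   means: g sends Rel_T(X_r) into Y_r for all r. So the V-cat-ification of X has on T X the
   distance sup {r | (s, t) in Rel_T(X_r)}. The triangle inequality holds because T preserves
   weak pullbacks, hence Rel_T preserves composition, and because the tensor preserves suprema.
   As Rel_T(X_r) is antitone in r, complete distributivity turns "r is below this supremum" into
   "(s, t) in Rel_T(X_q) for all q totally below r", which is the closure C. *)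

theory Submission
  imports Defs
begin

section \<open>Approximation of lattice elements from totally below\<close>

section \<open>Totally below\<close>

lemma totally_below_imp_le:
  fixes r :: "'v::complete_lattice"
  assumes "s \<lless> r" shows "s \<le> r"
proof -
  have "downset {..r}" by (auto simp: downset_def)
  moreover have "r \<le> Sup {..r}" by (auto intro: Sup_upper)
  ultimately have "s \<in> {..r}" using assms unfolding totally_below_def by metis
  then show ?thesis by simp
qed

text \<open>The empty downset already has supremum \<open>bot\<close>. Hence the closure at
  \<open>bot\<close> is an empty intersection, that is, the total relation on the carrier.\<close>

lemma not_totally_below_bot: "\<not> s \<lless> (bot :: 'v::complete_lattice)"
proof
  assume "s \<lless> bot"
  moreover have "downset ({} :: 'v set)" by (simp add: downset_def)
  ultimately have "s \<in> {}" unfolding totally_below_def by (metis bot_least)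
  then show False by simp
qed

text \<open>The value \<open>L r\<close> of the left adjoint is the least downset whose supremum
  reaches \<open>r\<close>. Its members therefore lie in every such downset, so they are totally
  below \<open>r\<close>.\<close>

lemma le_Sup_totally_below:
  fixes r :: "'v::complete_lattice"
  assumes "completely_distributive TYPE('v)"
  shows "r \<le> Sup {s. s \<lless> r}"
proof -
  obtain L :: "'v \<Rightarrow> 'v set" where L: "\<And>r. downset (L r)"
      "\<And>r D. downset D \<Longrightarrow> (L r \<subseteq> D \<longleftrightarrow> r \<le> Sup D)"
    using assms unfolding completely_distributive_def by metis
  have "r \<le> Sup (L r)" using L by blast
  also have "L r \<subseteq> {s. s \<lless> r}" unfolding totally_below_def using L(2) by auto
  then have "Sup (L r) \<le> Sup {s. s \<lless> r}" by (rule Sup_subset_mono)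
  finally show ?thesis .
qed

lemma le_if_totally_below_le:
  fixes r :: "'v::complete_lattice"
  assumes "completely_distributive TYPE('v)" "\<And>s. s \<lless> r \<Longrightarrow> s \<le> d"
  shows "r \<le> d"
  using le_Sup_totally_below[OF assms(1), of r] assms(2)
  by (meson Sup_least mem_Collect_eq order_trans)

text \<open>The bridge from suprema to closures: one direction is the definition of totally below,
  the other holds because \<open>r\<close> is bounded by the supremum of its approximants.\<close>

lemma le_Sup_downset_iff:
  fixes r :: "'v::complete_lattice"
  assumes "completely_distributive TYPE('v)" "downset D"
  shows "r \<le> Sup D \<longleftrightarrow> (\<forall>s. s \<lless> r \<longrightarrow> s \<in> D)"
proof
  show "\<forall>s. s \<lless> r \<longrightarrow> s \<in> D" if "r \<le> Sup D"
    using that assms(2) by (auto simp: totally_below_def)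
  show "r \<le> Sup D" if "\<forall>s. s \<lless> r \<longrightarrow> s \<in> D"
    using that by (meson le_if_totally_below_le[OF assms(1)] Sup_upper)
qed


section \<open>Tensor against suprema, and functions out of discrete V-categories\<close>

section \<open>Quantales and discrete V-categories\<close>

context comm_quantale
begin

text \<open>Residuation handles the supremum in one argument, and commutativity carries this over to
  the other. It serves to pass the triangle inequality to distances given by suprema.\<close>

lemma tensor_Sup_le:
  assumes "\<And>r s. r \<in> A \<Longrightarrow> s \<in> B \<Longrightarrow> r \<otimes> s \<le> d"
  shows "Sup A \<otimes> Sup B \<le> d"
proof -
  have "Sup B \<otimes> r \<le> d" if "r \<in> A" for r
    unfolding ihom_adjoint Sup_le_iff
    using assms[OF that] by (metis ihom_adjoint tensor_commute)
  then have "r \<otimes> Sup B \<le> d" if "r \<in> A" for r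
    using that by (simp add: tensor_commute)
  then show ?thesis by (simp add: ihom_adjoint Sup_le_iff)
qed

lemma tensor_bot: "bot \<otimes> r = bot" "r \<otimes> bot = bot"
proof -
  have "bot \<otimes> r \<le> bot" by (simp add: ihom_adjoint)
  then show "bot \<otimes> r = bot" by (simp add: bot_unique)
  then show "r \<otimes> bot = bot" by (simp add: tensor_commute)
qed

lemma is_vcat_discrete: "is_vcat V (discrete V A)"
  by (auto simp: is_vcat_def discrete_def tensor_unit tensor_bot)

text \<open>Discrete V-categories are free on their sets: for equal points reflexivity of
  \<open>Y\<close> suffices, and for distinct ones the distance \<open>bot\<close> imposes
  nothing.\<close>

lemma is_vfunctor_discrete_iff:
  assumes "is_vcat V Y"
  shows "is_vfunctor (discrete V A) Y f \<longleftrightarrow> f \<in> A \<rightarrow>\<^sub>E obj Y"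
  using assms by (auto simp: is_vfunctor_def discrete_def is_vcat_def PiE_iff)

lemma dist_vhom_discrete:
  assumes "is_vcat V Y" "f \<in> A \<rightarrow>\<^sub>E obj Y" "g \<in> A \<rightarrow>\<^sub>E obj Y"
  shows "dist (vhom (discrete V A) Y) f g = (INF y\<in>A. dist Y (f y) (g y))"
  using assms by (simp add: vhom_def is_vfunctor_discrete_iff) (simp add: discrete_def)

lemma obj_vhom_discrete:
  assumes "is_vcat V Y"
  shows "obj (vhom (discrete V A) Y) = A \<rightarrow>\<^sub>E obj Y"
  using assms by (simp add: vhom_def is_vfunctor_discrete_iff)

end

lemma obj_discrete [simp]: "obj (discrete V A) = A"
  by (simp add: discrete_def)

lemma VCat_simps:
  "EOb (VCat V U) = {X. is_vcat V X \<and> obj X \<in> small_sets U}"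
  "EHom (VCat V U) = vhom"
  "ECmp (VCat V U) X Y Z g f = compose (obj X) g f"
  by (simp_all add: VCat_def)

lemma SetE_simps:
  "EOb (SetE V U) = small_sets U"
  "EHom (SetE V U) A B = discrete V (A \<rightarrow>\<^sub>E B)"
  by (simp_all add: SetE_def Set_cat_def)

lemma obj_vhom: "obj (vhom X Y) = {f. is_vfunctor X Y f}"
  by (simp add: vhom_def)

lemma functor_comp_simps [simp]:
  "fo (G \<circ>\<^sub>F F) a = fo G (fo F a)"
  "fm (G \<circ>\<^sub>F F) a b f = fm G (fo F a) (fo F b) (fm F a b f)"
  by (simp_all add: functor_comp_def)

lemma compose_PiE: "f \<in> A \<rightarrow>\<^sub>E B \<Longrightarrow> g \<in> B \<rightarrow>\<^sub>E C \<Longrightarrow> compose A g f \<in> A \<rightarrow>\<^sub>E C"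
  by (auto simp: compose_def PiE_iff)

lemma compose_id_left: "f \<in> A \<rightarrow>\<^sub>E B \<Longrightarrow> compose A (\<lambda>x\<in>B. x) f = f"
  by (rule Id_compose) (auto simp: PiE_iff)

lemma compose_id_right: "f \<in> A \<rightarrow>\<^sub>E B \<Longrightarrow> compose A f (\<lambda>x\<in>A. x) = f"
  by (rule compose_Id) (auto simp: PiE_iff)

lemma is_functorD:
  assumes "is_functor C D F"
  shows "a \<in> Ob C \<Longrightarrow> fo F a \<in> Ob D"
    and "\<lbrakk>a \<in> Ob C; b \<in> Ob C; f \<in> Mor C a b\<rbrakk> \<Longrightarrow> fm F a b f \<in> Mor D (fo F a) (fo F b)"
    and "a \<in> Ob C \<Longrightarrow> fm F a a (Idm C a) = Idm D (fo F a)"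
    and "\<lbrakk>a \<in> Ob C; b \<in> Ob C; c \<in> Ob C; f \<in> Mor C a b; g \<in> Mor C b c\<rbrakk> \<Longrightarrow>
      fm F a c (Cmp C a b c g f) = Cmp D (fo F a) (fo F b) (fo F c) (fm F b c g) (fm F a b f)"
  using assms unfolding is_functor_def by blast+


section \<open>Calculus of lifted relations by spans\<close>

section \<open>Relation lifting along a functor preserving weak pullbacks\<close>

locale wpb_set_functor = set_universe U for U :: "'a universe" +
  fixes T :: "'a set_functor"
  assumes T_functor: "is_functor (Set_cat U) (Set_cat U) T"
    and T_wpb: "preserves_weak_pullbacks (Set_cat U) (Set_cat U) T"
begin

lemma small_empty: "{} \<in> small_sets U"
  using small_singleton small_subset by blast

lemma small_rel_obj:
  assumes "X \<in> small_sets U" "Y \<in> small_sets U" "R \<subseteq> X \<times> Y"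
  shows "rel_obj U R \<in> small_sets U"
proof -
  have "(\<Union>x\<in>X. \<Union>y\<in>Y. {pair U (x, y)}) \<in> small_sets U"
    using assms by (intro small_UN small_singleton) auto
  moreover have "rel_obj U R \<subseteq> (\<Union>x\<in>X. \<Union>y\<in>Y. {pair U (x, y)})"
    using assms(3) by (auto simp: rel_obj_def)
  ultimately show ?thesis by (rule small_subset)
qed

lemma T_small: "A \<in> small_sets U \<Longrightarrow> fo T A \<in> small_sets U"
  using is_functorD(1)[OF T_functor] by (simp add: Set_cat_def)

lemma T_PiE:
  "\<lbrakk>A \<in> small_sets U; B \<in> small_sets U; f \<in> A \<rightarrow>\<^sub>E B\<rbrakk> \<Longrightarrow> fm T A B f \<in> fo T A \<rightarrow>\<^sub>E fo T B"
  using is_functorD(2)[OF T_functor] by (simp add: Set_cat_def)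

lemma T_mem:
  "\<lbrakk>A \<in> small_sets U; B \<in> small_sets U; f \<in> A \<rightarrow>\<^sub>E B; t \<in> fo T A\<rbrakk> \<Longrightarrow> fm T A B f t \<in> fo T B"
  using T_PiE by blast

lemma T_id: "A \<in> small_sets U \<Longrightarrow> fm T A A (\<lambda>x\<in>A. x) = (\<lambda>x\<in>fo T A. x)"
  using is_functorD(3)[OF T_functor] by (simp add: Set_cat_def)

lemma T_compose:
  "\<lbrakk>A \<in> small_sets U; B \<in> small_sets U; C \<in> small_sets U; f \<in> A \<rightarrow>\<^sub>E B; g \<in> B \<rightarrow>\<^sub>E C\<rbrakk> \<Longrightarrow>
    fm T A C (compose A g f) = compose (fo T A) (fm T B C g) (fm T A B f)"
  using is_functorD(4)[OF T_functor, of A B C f g] by (simp add: Set_cat_def)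

lemma T_compose_apply:
  "\<lbrakk>A \<in> small_sets U; B \<in> small_sets U; C \<in> small_sets U; f \<in> A \<rightarrow>\<^sub>E B; g \<in> B \<rightarrow>\<^sub>E C; t \<in> fo T A\<rbrakk>
    \<Longrightarrow> fm T A C (compose A g f) t = fm T B C g (fm T A B f t)"
  by (simp add: T_compose compose_eq)

text \<open>Weak preservation of the pullback of \<open>f\<close> and \<open>g\<close>, tested on a one-point set.\<close>

lemma T_pullback_element:
  assumes small: "A \<in> small_sets U" "B \<in> small_sets U" "Z \<in> small_sets U"
    and fg: "f \<in> A \<rightarrow>\<^sub>E Z" "g \<in> B \<rightarrow>\<^sub>E Z"
    and cd: "c \<in> fo T A" "d \<in> fo T B" "fm T A Z f c = fm T B Z g d"
  obtains P p q w where "P \<in> small_sets U" "p \<in> P \<rightarrow>\<^sub>E A" "q \<in> P \<rightarrow>\<^sub>E B"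
    "\<And>x. x \<in> P \<Longrightarrow> f (p x) = g (q x)" "w \<in> fo T P" "fm T P A p w = c" "fm T P B q w = d"
proof -
  \<comment> \<open>The set-theoretic pullback of \<open>f\<close> and \<open>g\<close>, coded as a
    small set by the pairing operation; the square that it spans is the one to which
    \<open>T\<close> is applied.\<close>
  define R where "R = {(a, b). a \<in> A \<and> b \<in> B \<and> f a = g b}"
  define P where "P = rel_obj U R"
  define p where "p = rel_fst U R"
  define q where "q = rel_snd U R"
  have R: "R \<subseteq> A \<times> B" by (auto simp: R_def)
  have P: "P \<in> small_sets U" unfolding P_def by (rule small_rel_obj[OF small(1,2) R])
  have p_pair: "p (pair U (a, b)) = a" and q_pair: "q (pair U (a, b)) = b"
    if "(a, b) \<in> R" for a b
    using that by (auto simp: p_def q_def rel_fst_def rel_snd_def rel_obj_def inv_f_f[OF pair_inj])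
  have pq: "p \<in> P \<rightarrow>\<^sub>E A" "q \<in> P \<rightarrow>\<^sub>E B"
    using R by (auto simp: p_def q_def P_def rel_fst_def rel_snd_def rel_obj_def inv_f_f[OF pair_inj])
  have comm: "f (p x) = g (q x)" if "x \<in> P" for x
    using that by (auto simp: P_def rel_obj_def p_pair q_pair) (auto simp: R_def)
  have "weak_pullback (Set_cat U) P A B Z p q f g"
    unfolding weak_pullback_def Set_cat_def
  proof (simp add: small P pq fg, intro conjI ballI impI)
    show "compose P f p = compose P g q"
      using comm by (auto simp: compose_def fun_eq_iff)
    fix Q u v
    assume Q: "Q \<in> small_sets U" and u: "u \<in> Q \<rightarrow>\<^sub>E A" and v: "v \<in> Q \<rightarrow>\<^sub>E B"
      and eq: "compose Q f u = compose Q g v"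
    have R_uv: "(u x, v x) \<in> R" if "x \<in> Q" for x
      using that u v fun_cong[OF eq, of x] by (auto simp: R_def compose_def)
    show "\<exists>w\<in>Q \<rightarrow>\<^sub>E P. compose Q p w = u \<and> compose Q q w = v"
    proof (intro bexI conjI)
      show "(\<lambda>x\<in>Q. pair U (u x, v x)) \<in> Q \<rightarrow>\<^sub>E P"
        using R_uv by (auto simp: P_def rel_obj_def)
      show "compose Q p (\<lambda>x\<in>Q. pair U (u x, v x)) = u"
        using u R_uv by (auto simp: compose_def fun_eq_iff p_pair PiE_iff extensional_def)
      show "compose Q q (\<lambda>x\<in>Q. pair U (u x, v x)) = v"
        using v R_uv by (auto simp: compose_def fun_eq_iff q_pair PiE_iff extensional_def)
    qed
  qed
  then have wp: "weak_pullback (Set_cat U) (fo T P) (fo T A) (fo T B) (fo T Z)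
      (fm T P A p) (fm T P B q) (fm T A Z f) (fm T B Z g)"
    using T_wpb unfolding preserves_weak_pullbacks_def by blast
  \<comment> \<open>Any element serves: functions out of the small set \<open>{x}\<close> are just
    elements, so the weak universal property turns \<open>c\<close> and \<open>d\<close> into an
    element of \<open>fo T P\<close>.\<close>
  define x :: 'a where "x = undefined"
  have lift: "\<forall>Q\<in>small_sets U. \<forall>u\<in>Q \<rightarrow>\<^sub>E fo T A. \<forall>v\<in>Q \<rightarrow>\<^sub>E fo T B.
      compose Q (fm T A Z f) u = compose Q (fm T B Z g) v \<longrightarrow>
      (\<exists>w\<in>Q \<rightarrow>\<^sub>E fo T P. compose Q (fm T P A p) w = u \<and> compose Q (fm T P B q) w = v)"
    using wp unfolding weak_pullback_def Set_cat_def by simp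
  have "compose {x} (fm T A Z f) (\<lambda>y\<in>{x}. c) = compose {x} (fm T B Z g) (\<lambda>y\<in>{x}. d)"
    using cd(3) by (simp add: compose_def fun_eq_iff)
  moreover have "(\<lambda>y\<in>{x}. c) \<in> {x} \<rightarrow>\<^sub>E fo T A" "(\<lambda>y\<in>{x}. d) \<in> {x} \<rightarrow>\<^sub>E fo T B"
    using cd(1,2) by auto
  ultimately obtain w where w: "w \<in> {x} \<rightarrow>\<^sub>E fo T P"
      "compose {x} (fm T P A p) w = (\<lambda>y\<in>{x}. c)" "compose {x} (fm T P B q) w = (\<lambda>y\<in>{x}. d)"
    using lift small_singleton[of x] by blast
  show ?thesis
  proof (rule that[OF P pq comm])
    show "w x \<in> fo T P" using w(1) by auto
    show "fm T P A p (w x) = c" using fun_cong[OF w(2), of x] by (simp add: compose_def)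
    show "fm T P B q (w x) = d" using fun_cong[OF w(3), of x] by (simp add: compose_def)
  qed auto
qed

text \<open>Lifted pairs arise from arbitrary small spans over the relation, not just the canonical one.\<close>

lemma rel_lift_iff:
  assumes "X \<in> small_sets U" "Y \<in> small_sets U" "R \<subseteq> X \<times> Y"
  shows "(s, t) \<in> rel_lift U T X Y R \<longleftrightarrow>
    (\<exists>A\<in>small_sets U. \<exists>h\<in>A \<rightarrow>\<^sub>E X. \<exists>k\<in>A \<rightarrow>\<^sub>E Y. \<exists>c\<in>fo T A.
      (\<forall>a\<in>A. (h a, k a) \<in> R) \<and> s = fm T A X h c \<and> t = fm T A Y k c)"
    (is "?L \<longleftrightarrow> ?R")
proof
  have P: "rel_obj U R \<in> small_sets U" by (rule small_rel_obj[OF assms])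
  have p: "rel_fst U R \<in> rel_obj U R \<rightarrow>\<^sub>E X" and q: "rel_snd U R \<in> rel_obj U R \<rightarrow>\<^sub>E Y"
    using assms(3) by (auto simp: rel_fst_def rel_snd_def rel_obj_def inv_f_f[OF pair_inj])
  {
    assume ?L
    moreover have "\<forall>a\<in>rel_obj U R. (rel_fst U R a, rel_snd U R a) \<in> R"
      by (auto simp: rel_fst_def rel_snd_def rel_obj_def inv_f_f[OF pair_inj])
    ultimately show ?R
      using P p q unfolding rel_lift_def by blast
  next
    assume ?R
    then obtain A h k c where A: "A \<in> small_sets U" and h: "h \<in> A \<rightarrow>\<^sub>E X" and k: "k \<in> A \<rightarrow>\<^sub>E Y"
      and c: "c \<in> fo T A" and R: "\<forall>a\<in>A. (h a, k a) \<in> R"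
      and st: "s = fm T A X h c" "t = fm T A Y k c" by blast
    \<comment> \<open>A span over \<open>R\<close> factors through the canonical one by pairing its
      legs, and \<open>T m\<close> carries \<open>c\<close> to the element of
      \<open>fo T (rel_obj U R)\<close> that \<open>rel_lift\<close> asks for.\<close>
    define m where "m = (\<lambda>a\<in>A. pair U (h a, k a))"
    have m: "m \<in> A \<rightarrow>\<^sub>E rel_obj U R" using R by (auto simp: m_def rel_obj_def)
    have "compose A (rel_fst U R) m = h" "compose A (rel_snd U R) m = k"
      using h k R by (auto simp: compose_def fun_eq_iff m_def rel_fst_def rel_snd_def rel_obj_def
          inv_f_f[OF pair_inj] PiE_iff extensional_def)
    then have "s = fm T (rel_obj U R) X (rel_fst U R) (fm T A (rel_obj U R) m c)"
      "t = fm T (rel_obj U R) Y (rel_snd U R) (fm T A (rel_obj U R) m c)"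
      using T_compose_apply[OF A P assms(1) m p c] T_compose_apply[OF A P assms(2) m q c] st
      by simp_all
    then show ?L using T_mem[OF A P m c] unfolding rel_lift_def by blast
  }
qed

lemma rel_lift_subset:
  assumes "X \<in> small_sets U" "Y \<in> small_sets U" "R \<subseteq> X \<times> Y"
  shows "rel_lift U T X Y R \<subseteq> fo T X \<times> fo T Y"
proof
  fix z assume "z \<in> rel_lift U T X Y R"
  then show "z \<in> fo T X \<times> fo T Y"
    using rel_lift_iff[OF assms, of "fst z" "snd z"] T_mem assms(1,2) by (cases z) fastforce
qed

lemma rel_lift_mono:
  assumes "X \<in> small_sets U" "Y \<in> small_sets U" "R \<subseteq> S" "S \<subseteq> X \<times> Y"
  shows "rel_lift U T X Y R \<subseteq> rel_lift U T X Y S"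
proof clarify
  fix s t assume "(s, t) \<in> rel_lift U T X Y R"
  moreover have R: "R \<subseteq> X \<times> Y" using assms(3,4) by (rule order_trans)
  ultimately show "(s, t) \<in> rel_lift U T X Y S"
    unfolding rel_lift_iff[OF assms(1,2) R] rel_lift_iff[OF assms(1,2,4)]
    using assms(3) by (meson subsetD)
qed

text \<open>The two legs of a span over the diagonal coincide; conversely the identity span on
  \<open>X\<close> realises all diagonal pairs because \<open>T\<close> preserves
  identities.\<close>

lemma rel_lift_Id_on:
  assumes X: "X \<in> small_sets U"
  shows "rel_lift U T X X (Id_on X) = Id_on (fo T X)"
proof -
  have sub: "Id_on X \<subseteq> X \<times> X" by auto
  have "s = t \<and> s \<in> fo T X" if st: "(s, t) \<in> rel_lift U T X X (Id_on X)" for s t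
  proof -
    obtain A h k c where *: "A \<in> small_sets U" "h \<in> A \<rightarrow>\<^sub>E X" "k \<in> A \<rightarrow>\<^sub>E X" "c \<in> fo T A"
      "\<forall>a\<in>A. (h a, k a) \<in> Id_on X" "s = fm T A X h c" "t = fm T A X k c"
      using st unfolding rel_lift_iff[OF X X sub] by blast
    then have "h = k" by (intro PiE_ext[OF *(2,3)]) auto
    with * T_mem[OF *(1) X *(2)] show ?thesis by simp
  qed
  moreover have "(t, t) \<in> rel_lift U T X X (Id_on X)" if "t \<in> fo T X" for t
    unfolding rel_lift_iff[OF X X sub]
    using X that T_id[OF X]
    by (intro bexI[of _ X] bexI[of _ "\<lambda>x\<in>X. x"] bexI[of _ t]) auto
  ultimately show ?thesis by auto
qed

text \<open>Weak pullbacks compose spans: the witnesses \<open>c\<close> and \<open>d\<close> have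
  the same image \<open>t\<close>, hence come from one \<open>w\<close> over the pullback of the
  inner legs \<open>k\<close> and \<open>f\<close>, whose outer legs form a span over
  \<open>R O S\<close>.\<close>

lemma rel_lift_relcomp:
  assumes X: "X \<in> small_sets U" and Y: "Y \<in> small_sets U" and Z: "Z \<in> small_sets U"
    and R: "R \<subseteq> X \<times> Y" and S: "S \<subseteq> Y \<times> Z"
  shows "rel_lift U T X Y R O rel_lift U T Y Z S \<subseteq> rel_lift U T X Z (R O S)"
proof clarify
  fix s t u assume st: "(s, t) \<in> rel_lift U T X Y R" and tu: "(t, u) \<in> rel_lift U T Y Z S"
  from st obtain A h k c where A: "A \<in> small_sets U" and h: "h \<in> A \<rightarrow>\<^sub>E X" and k: "k \<in> A \<rightarrow>\<^sub>E Y"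
    and c: "c \<in> fo T A" and hk: "\<forall>a\<in>A. (h a, k a) \<in> R"
    and s: "s = fm T A X h c" and t: "t = fm T A Y k c"
    unfolding rel_lift_iff[OF X Y R] by blast
  from tu obtain B f g d where B: "B \<in> small_sets U" and f: "f \<in> B \<rightarrow>\<^sub>E Y" and g: "g \<in> B \<rightarrow>\<^sub>E Z"
    and d: "d \<in> fo T B" and fg: "\<forall>b\<in>B. (f b, g b) \<in> S"
    and t': "t = fm T B Y f d" and u: "u = fm T B Z g d"
    unfolding rel_lift_iff[OF Y Z S] by blast
  obtain P p q w where P: "P \<in> small_sets U" and p: "p \<in> P \<rightarrow>\<^sub>E A" and q: "q \<in> P \<rightarrow>\<^sub>E B"
    and comm: "\<And>x. x \<in> P \<Longrightarrow> k (p x) = f (q x)" and w: "w \<in> fo T P"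
    and pw: "fm T P A p w = c" and qw: "fm T P B q w = d"
    using T_pullback_element[OF A B Y k f c d] t t' by metis
  have RS: "R O S \<subseteq> X \<times> Z" using R S by auto
  have "(compose P h p x, compose P g q x) \<in> R O S" if "x \<in> P" for x
  proof (rule relcompI)
    show "(compose P h p x, k (p x)) \<in> R" using that hk p by (auto simp: compose_def)
    show "(k (p x), compose P g q x) \<in> S" using that fg q comm by (auto simp: compose_def)
  qed
  moreover have "s = fm T P X (compose P h p) w" "u = fm T P Z (compose P g q) w"
    using T_compose_apply[OF P A X p h w] T_compose_apply[OF P B Z q g w] pw qw s u by simp_all
  ultimately show "(s, u) \<in> rel_lift U T X Z (R O S)"
    unfolding rel_lift_iff[OF X Z RS]
    using P w compose_PiE[OF p h] compose_PiE[OF q g] by blast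
qed

text \<open>Both legs of a span over \<open>R\<close> are composed with \<open>f\<close>. This gives
  the action of the lifting on presheaf morphisms.\<close>

lemma rel_lift_map:
  assumes X: "X \<in> small_sets U" and Y: "Y \<in> small_sets U"
    and R: "R \<subseteq> X \<times> X" and S: "S \<subseteq> Y \<times> Y"
    and f: "f \<in> X \<rightarrow>\<^sub>E Y" and fRS: "\<And>x' x. (x', x) \<in> R \<Longrightarrow> (f x', f x) \<in> S"
    and st: "(s, t) \<in> rel_lift U T X X R"
  shows "(fm T X Y f s, fm T X Y f t) \<in> rel_lift U T Y Y S"
proof -
  from st obtain A h k c where A: "A \<in> small_sets U" and h: "h \<in> A \<rightarrow>\<^sub>E X" and k: "k \<in> A \<rightarrow>\<^sub>E X"
    and c: "c \<in> fo T A" and hk: "\<forall>a\<in>A. (h a, k a) \<in> R"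
    and s: "s = fm T A X h c" and t: "t = fm T A X k c"
    unfolding rel_lift_iff[OF X X R] by blast
  have "\<forall>a\<in>A. (compose A f h a, compose A f k a) \<in> S"
    using hk fRS by (auto simp: compose_def)
  moreover have "fm T X Y f s = fm T A Y (compose A f h) c"
    "fm T X Y f t = fm T A Y (compose A f k) c"
    using T_compose_apply[OF A X Y h f c] T_compose_apply[OF A X Y k f c] s t by simp_all
  ultimately show ?thesis
    unfolding rel_lift_iff[OF Y Y S] using A c compose_PiE[OF h f] compose_PiE[OF k f] by blast
qed

text \<open>A span over the empty relation has an empty apex, so its witness is an element of
  \<open>fo T {}\<close>.\<close>

lemma T_empty_nonempty_if_rel_lift_empty:
  assumes X: "X \<in> small_sets U" and t: "(s, t) \<in> rel_lift U T X X {}"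
  shows "fo T {} \<noteq> {}"
proof -
  obtain A c where "A \<in> small_sets U" "c \<in> fo T A" "\<forall>a\<in>A. False"
    using t unfolding rel_lift_iff[OF X X empty_subsetI] by auto
  moreover from this have "A = {}" by blast
  ultimately show ?thesis by auto
qed

text \<open>Under \<open>T\<close> of the constant map to \<open>{x}\<close> any two elements
  \<open>s\<close> and \<open>t\<close> get the same image, so the weak pullback of that map with
  itself provides a span relating them.\<close>

lemma rel_lift_total:
  assumes X: "X \<in> small_sets U" and sub: "\<And>s t. s \<in> fo T {x} \<Longrightarrow> t \<in> fo T {x} \<Longrightarrow> s = t"
  shows "rel_lift U T X X (X \<times> X) = fo T X \<times> fo T X"
proof
  show "rel_lift U T X X (X \<times> X) \<subseteq> fo T X \<times> fo T X" by (rule rel_lift_subset[OF X X subset_refl])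
  have b: "(\<lambda>y\<in>X. x) \<in> X \<rightarrow>\<^sub>E {x}" by auto
  show "fo T X \<times> fo T X \<subseteq> rel_lift U T X X (X \<times> X)"
  proof clarify
    fix s t assume s: "s \<in> fo T X" and t: "t \<in> fo T X"
    have "fm T X {x} (\<lambda>y\<in>X. x) s = fm T X {x} (\<lambda>y\<in>X. x) t"
      using T_mem[OF X small_singleton b] s t by (intro sub)
    then obtain P p q w where "P \<in> small_sets U" "p \<in> P \<rightarrow>\<^sub>E X" "q \<in> P \<rightarrow>\<^sub>E X"
      "w \<in> fo T P" "fm T P X p w = s" "fm T P X q w = t"
      by (rule T_pullback_element[OF X X small_singleton b b s t])
    then show "(s, t) \<in> rel_lift U T X X (X \<times> X)"
      unfolding rel_lift_iff[OF X X subset_refl] by blast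
  qed
qed

end

section \<open>Relational presheaves: lifting, closure and the discrete squares\<close>

section \<open>Discrete presheaves, lifting and closure\<close>

lemma \<Phi>_simps [simp]:
  "carrier (fo \<Phi> X) = obj X"
  "rel (fo \<Phi> X) r = {(x', x). x' \<in> obj X \<and> x \<in> obj X \<and> r \<le> dist X x' x}"
  "fm \<Phi> X Y f = f"
  by (simp_all add: \<Phi>_def)

lemma RelLift_simps [simp]:
  "carrier (fo (RelLift U T) F) = fo T (carrier F)"
  "rel (fo (RelLift U T) F) r = rel_lift U T (carrier F) (carrier F) (rel F r)"
  "fm (RelLift U T) F G f = fm T (carrier F) (carrier G) f"
  by (simp_all add: RelLift_def)

lemma Closure_simps [simp]:
  "carrier (fo Closure F) = carrier F"
  "rel (fo Closure F) r = (carrier F \<times> carrier F) \<inter> (\<Inter>s\<in>{s. s \<lless> r}. rel F s)"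
  "fm Closure F G f = f"
  by (simp_all add: Closure_def)

lemma DiscR_simps [simp]:
  "carrier (fo (DiscR V) X) = X"
  "fm (DiscR V) X Y f = f"
  by (simp_all add: DiscR_def Disc_def)

lemma rpresh_eq_iff:
  fixes F G :: "('a, 'v) rpresh"
  shows "F = G \<longleftrightarrow> carrier F = carrier G \<and> rel F = rel G"
  by (cases F, cases G) simp

lemma is_rpreshD:
  assumes "is_rpresh V F"
  shows "rel F r \<subseteq> carrier F \<times> carrier F"
    and "Id_on (carrier F) \<subseteq> rel F \<e>\<^bsub>V\<^esub>"
    and "rel F s O rel F r \<subseteq> rel F (r \<otimes>\<^bsub>V\<^esub> s)"
    and "s \<le> r \<Longrightarrow> rel F r \<subseteq> rel F s"
  using assms by (simp_all add: is_rpresh_def)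

lemma (in comm_quantale) is_rpresh_\<Phi>:
  assumes "is_vcat V X" shows "is_rpresh V (fo \<Phi> X)"
  unfolding is_rpresh_def
proof (intro conjI allI impI)
  show "Id_on (carrier (fo \<Phi> X)) \<subseteq> rel (fo \<Phi> X) \<e>"
    using assms by (auto simp: is_vcat_def)
  show "rel (fo \<Phi> X) s O rel (fo \<Phi> X) r \<subseteq> rel (fo \<Phi> X) (r \<otimes> s)" for r s
  proof clarsimp
    fix x y z assume *: "x \<in> obj X" "y \<in> obj X" "z \<in> obj X" "s \<le> dist X x y" "r \<le> dist X y z"
    then have "r \<otimes> s \<le> dist X y z \<otimes> dist X x y" by (intro tensor_mono)
    also have "\<dots> \<le> dist X x z" using assms * unfolding is_vcat_def by blast
    finally show "r \<otimes> s \<le> dist X x z" .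
  qed
qed auto

text \<open>The three levels at which the squares of the diagram are compared. The lifting always
  preserves the middle one, while the total and the empty relation need conditions on
  \<open>T\<close>.\<close>

lemma (in comm_quantale) rel_DiscR:
  "rel (fo (DiscR V) X) r =
    (if r = bot then X \<times> X else if r \<le> \<e> then Id_on X else {})"
  by (auto simp: DiscR_def Disc_def discrete_def bot_unique)

locale quantale_set_functor = wpb_set_functor U T + comm_quantale V
  for U :: "'a universe" and T and V :: "'v::complete_lattice quantale" (structure) +
  assumes cd: "completely_distributive TYPE('v)"
begin

lemma top_neq_bot: "(top :: 'v) \<noteq> bot"
  using nontrivial by (metis bot_unique top_greatest)

text \<open>The lifting preserves identity relations, inclusions and, laxly, composites, which
  transports the presheaf axioms one by one.\<close>

lemma is_rpresh_RelLift:
  assumes F: "is_rpresh V F" and small: "carrier F \<in> small_sets U"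
  shows "is_rpresh V (fo (RelLift U T) F)"
proof -
  note D = is_rpreshD[OF F]
  note mono = rel_lift_mono[OF small small _ D(1)]
  have "Id_on (fo T (carrier F)) \<subseteq> rel_lift U T (carrier F) (carrier F) (rel F \<e>)"
    using mono[OF D(2)] unfolding rel_lift_Id_on[OF small] .
  moreover have "rel_lift U T (carrier F) (carrier F) (rel F s) O
      rel_lift U T (carrier F) (carrier F) (rel F r)
      \<subseteq> rel_lift U T (carrier F) (carrier F) (rel F (r \<otimes> s))" for r s
    using rel_lift_relcomp[OF small small small D(1) D(1)] mono[OF D(3)] by (rule order_trans)
  moreover have "rel_lift U T (carrier F) (carrier F) (rel F r)
      \<subseteq> rel_lift U T (carrier F) (carrier F) (rel F s)" if "s \<le> r" for r s
    using D(4)[OF that] by (rule mono)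
  ultimately show ?thesis
    using rel_lift_subset[OF small small D(1)] unfolding is_rpresh_def by simp
qed

lemma is_functor_RelLift: "is_functor (RelPresh\<^sub>c V U) (RelPresh V U) (RelLift U T)"
proof -
  have "fm T (carrier F) (carrier G) f \<in> rpresh_mor (fo (RelLift U T) F) (fo (RelLift U T) G)"
    if F: "is_rpresh V F" "carrier F \<in> small_sets U" and G: "is_rpresh V G" "carrier G \<in> small_sets U"
      and f: "f \<in> rpresh_mor F G" for F G f
  proof -
    note sub = is_rpreshD(1)[OF F(1)] is_rpreshD(1)[OF G(1)]
    have fFG: "f \<in> carrier F \<rightarrow>\<^sub>E carrier G"
      and f_rel: "\<And>r x' x. (x', x) \<in> rel F r \<Longrightarrow> (f x', f x) \<in> rel G r"
      using f by (auto simp: rpresh_mor_def)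
    show ?thesis
      using T_PiE[OF F(2) G(2) fFG] rel_lift_map[OF F(2) G(2) sub fFG f_rel]
      by (simp add: rpresh_mor_def)
  qed
  then show ?thesis
    unfolding is_functor_def RelPresh\<^sub>c_def RelPresh_def
    by (auto simp: is_rpresh_RelLift T_small T_id T_compose rpresh_mor_def)
qed

text \<open>A bound \<open>r \<le> d\<close> on a distance can be tested on the elements totally
  below \<open>r\<close>, so closing the presheaf of a V-category adds nothing.\<close>

lemma Closure_DiscR: "functor_eq (Set_cat U) (Closure \<circ>\<^sub>F DiscR V) (DiscR V)"
proof -
  have "rel (fo Closure (fo (DiscR V) X)) r = rel (fo (DiscR V) X) r" for X :: "'a set" and r
    by (auto simp: DiscR_def Disc_def intro: le_if_totally_below_le[OF cd] dest: totally_below_imp_le)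
  then show ?thesis by (auto simp: functor_eq_def rpresh_eq_iff fun_eq_iff)
qed

text \<open>On the empty set the empty relation is the diagonal, so its lift is the diagonal of
  \<open>fo T {}\<close>; conversely every pair lifted from the empty relation has a witness in
  \<open>fo T {}\<close>.\<close>

lemma rel_lift_empty_eq_empty_iff:
  "(\<forall>X\<in>small_sets U. rel_lift U T X X {} = {}) \<longleftrightarrow> fo T {} = {}"
proof
  assume "\<forall>X\<in>small_sets U. rel_lift U T X X {} = {}"
  then show "fo T {} = {}" using rel_lift_Id_on[OF small_empty] small_empty by auto
next
  assume "fo T {} = {}"
  then show "\<forall>X\<in>small_sets U. rel_lift U T X X {} = {}"
    using T_empty_nonempty_if_rel_lift_empty by fastforce
qed

text \<open>The presheaves are compared level by level. At \<open>bot\<close> the lift of a total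
  relation must be total; a level not below \<open>\<e>\<close> exists exactly if
  \<open>\<e>\<close> is not \<open>top\<close>, and there the lift of the empty relation must be
  empty.\<close>

lemma RelLift_DiscR_iff:
  "functor_eq (Set_cat U) (RelLift U T \<circ>\<^sub>F DiscR V) (DiscR V \<circ>\<^sub>F T) \<longleftrightarrow>
    (\<forall>x. \<forall>s\<in>fo T {x}. \<forall>t\<in>fo T {x}. s = t) \<and> (\<e> = top \<or> fo T {} = {})"
proof -
  have "functor_eq (Set_cat U) (RelLift U T \<circ>\<^sub>F DiscR V) (DiscR V \<circ>\<^sub>F T) \<longleftrightarrow>
    (\<forall>X\<in>small_sets U. \<forall>r. rel_lift U T X X (rel (fo (DiscR V) X) r) = rel (fo (DiscR V) (fo T X)) r)"
    by (auto simp: functor_eq_def rpresh_eq_iff fun_eq_iff Set_cat_def)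
  also have "\<dots> \<longleftrightarrow> (\<forall>X\<in>small_sets U. rel_lift U T X X (X \<times> X) = fo T X \<times> fo T X) \<and>
      (\<e> = top \<or> (\<forall>X\<in>small_sets U. rel_lift U T X X {} = {}))" (is "?L \<longleftrightarrow> ?R")
  proof
    assume L: ?L
    \<comment> \<open>The level \<open>top\<close> is neither \<open>bot\<close> nor, in this case,
      below \<open>\<e>\<close>, so the discrete presheaf is empty there.\<close>
    have "rel_lift U T X X {} = {}" if "\<e> \<noteq> top" "X \<in> small_sets U" for X
      using L[rule_format, OF that(2), of top] that(1) top_neq_bot by (simp add: rel_DiscR top_unique)
    moreover have "rel_lift U T X X (X \<times> X) = fo T X \<times> fo T X" if "X \<in> small_sets U" for X
      using L[rule_format, OF that, of bot] by (simp add: rel_DiscR)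
    ultimately show ?R by blast
  next
    assume ?R
    then show ?L by (auto simp: rel_DiscR rel_lift_Id_on)
  qed
  also have "(\<forall>X\<in>small_sets U. rel_lift U T X X (X \<times> X) = fo T X \<times> fo T X) \<longleftrightarrow>
      (\<forall>x. \<forall>s\<in>fo T {x}. \<forall>t\<in>fo T {x}. s = t)" (is "?L \<longleftrightarrow> ?R")
  proof
    assume ?L
    \<comment> \<open>On a one-point set the total relation is the diagonal, whose lift is the
      diagonal of \<open>fo T {x}\<close>.\<close>
    then have "Id_on (fo T {x}) = fo T {x} \<times> fo T {x}" for x
      using rel_lift_Id_on[OF small_singleton, of x] small_singleton[of x] by (auto simp: Id_on_def)
    then show ?R by blast
  next
    assume ?R
    then show ?L using rel_lift_total by blast
  qed
  finally show ?thesis unfolding rel_lift_empty_eq_empty_iff .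
qed

text \<open>The lifts of the empty, diagonal and total relation form a chain, so each intersection
  is decided by the smallest lift occurring in it. At \<open>bot\<close> there is nothing to
  intersect, whatever the lift of the total relation is.\<close>

lemma rel_Closure_RelLift_DiscR:
  assumes X: "X \<in> small_sets U"
  shows "rel (fo Closure (fo (RelLift U T) (fo (DiscR V) X))) r =
    (if r = bot then fo T X \<times> fo T X else if r \<le> \<e> then Id_on (fo T X) else rel_lift U T X X {})"
proof -
  let ?L = "rel_lift U T X X"
  have empty: "?L {} \<subseteq> Id_on (fo T X)"
    using rel_lift_mono[OF X X, of "{}" "Id_on X"] rel_lift_Id_on[OF X] by auto
  have total: "Id_on (fo T X) \<subseteq> ?L (X \<times> X)"
    using rel_lift_mono[OF X X, of "Id_on X" "X \<times> X"] rel_lift_Id_on[OF X] by auto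
  have lift: "?L (rel (fo (DiscR V) X) s) =
      (if s = bot then ?L (X \<times> X) else if s \<le> \<e> then Id_on (fo T X) else ?L {})" for s
    by (simp add: rel_DiscR rel_lift_Id_on[OF X])
  have rel: "rel (fo Closure (fo (RelLift U T) (fo (DiscR V) X))) r = (fo T X \<times> fo T X) \<inter>
     (\<Inter>s\<in>{s. s \<lless> r}. if s = bot then ?L (X \<times> X) else if s \<le> \<e> then Id_on (fo T X) else ?L {})"
    unfolding Closure_simps RelLift_simps DiscR_simps lift ..
  consider "r = bot" | "r \<noteq> bot" "r \<le> \<e>" | "\<not> r \<le> \<e>" by blast
  then show ?thesis
  proof cases
    case 1
    then show ?thesis unfolding rel by (simp add: not_totally_below_bot)
  next
    case 2
    \<comment> \<open>If only \<open>bot\<close> were totally below \<open>r\<close>, then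
      \<open>r\<close> itself would be \<open>bot\<close>. So the diagonal does occur in the
      intersection.\<close>
    then obtain s where "s \<lless> r" "s \<noteq> bot"
      using le_if_totally_below_le[OF cd, of r bot] by (auto simp: bot_unique)
    moreover have "s \<le> \<e>" if "s \<lless> r" for s
      using totally_below_imp_le[OF that] 2 by order
    ultimately show ?thesis using 2 total unfolding rel by (fastforce split: if_splits)
  next
    case 3
    \<comment> \<open>If all approximants of \<open>r\<close> were below \<open>\<e>\<close>, so
      would be \<open>r\<close>. So the lift of the empty relation occurs in the
      intersection.\<close>
    then obtain s where s: "s \<lless> r" "\<not> s \<le> \<e>"
      using le_if_totally_below_le[OF cd, of r "\<e>"] by blast
    moreover have "s \<noteq> bot" "r \<noteq> bot" using s(2) 3 by auto
    ultimately show ?thesis using 3 total empty unfolding rel by (fastforce split: if_splits)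
  qed
qed

text \<open>Closing makes the value at \<open>bot\<close> total, which leaves only the levels not
  below \<open>\<e>\<close>. If \<open>fo T {}\<close> is inhabited, spans with empty apex put
  diagonal pairs into the lifted relation at every level, whereas a discrete distance is at most
  \<open>\<e>\<close>.\<close>

lemma Closure_RelLift_DiscR_iff:
  "functor_eq (Set_cat U) (Closure \<circ>\<^sub>F RelLift U T \<circ>\<^sub>F DiscR V) (DiscR V \<circ>\<^sub>F T) \<longleftrightarrow>
    \<e> = top \<or> fo T {} = {}"
proof -
  have "functor_eq (Set_cat U) (Closure \<circ>\<^sub>F RelLift U T \<circ>\<^sub>F DiscR V) (DiscR V \<circ>\<^sub>F T) \<longleftrightarrow>
    (\<forall>X\<in>small_sets U. \<forall>r. rel (fo Closure (fo (RelLift U T) (fo (DiscR V) X))) r =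
      rel (fo (DiscR V) (fo T X)) r)"
    by (auto simp: functor_eq_def rpresh_eq_iff fun_eq_iff Set_cat_def simp del: Closure_simps(2))
  also have "\<dots> \<longleftrightarrow> \<e> = top \<or> (\<forall>X\<in>small_sets U. rel_lift U T X X {} = {})" (is "?L \<longleftrightarrow> ?R")
  proof
    assume L: ?L
    have "rel_lift U T X X {} = {}" if "\<e> \<noteq> top" "X \<in> small_sets U" for X
      using L[rule_format, OF that(2), of top] that top_neq_bot
      by (simp add: rel_Closure_RelLift_DiscR rel_DiscR top_unique del: Closure_simps(2))
    then show ?R by blast
  next
    assume ?R
    then show ?L
      by (auto simp: rel_Closure_RelLift_DiscR rel_DiscR simp del: Closure_simps(2))
  qed
  finally show ?thesis unfolding rel_lift_empty_eq_empty_iff .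
qed

end


section \<open>Distances on \<open>T X\<close> as suprema over spans\<close>

section \<open>The V-cat-ification\<close>

text \<open>The lifted presheaf need not be continuous, hence the supremum of all levels at which a
  pair is related. For a small \<open>X\<close>, a pair outside the carrier gets the empty supremum,
  as the normalisation to \<open>bot\<close> demands.\<close>

definition vcatification :: "'a universe \<Rightarrow> 'a set_functor
    \<Rightarrow> (('a, 'v::complete_lattice) vcat, 'a \<Rightarrow> 'a, ('a, 'v) vcat, 'a \<Rightarrow> 'a) ftr" where
  "vcatification U T =
     \<lparr>fo = (\<lambda>X. \<lparr>obj = fo T (obj X),
                 dist = (\<lambda>s t. Sup {r. (s, t) \<in> rel (fo (RelLift U T) (fo \<Phi> X)) r})\<rparr>),
      fm = (\<lambda>X Y f. fm T (obj X) (obj Y) f)\<rparr>"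

lemma vcatification_simps [simp]:
  "obj (fo (vcatification U T) X) = fo T (obj X)"
  "fm (vcatification U T) X Y f = fm T (obj X) (obj Y) f"
  by (simp_all add: vcatification_def)

lemma dist_vcatification:
  "dist (fo (vcatification U T) X) s t = Sup {r. (s, t) \<in> rel (fo (RelLift U T) (fo \<Phi> X)) r}"
  by (simp add: vcatification_def)

context quantale_set_functor
begin

text \<open>The next two lemmas say that the distance from \<open>s\<close> to \<open>t\<close> is the supremum, over all spans
  \<open>h, k : A \<rightarrow> X\<close> lifting to the pair, of the distance from \<open>h\<close> to \<open>k\<close> in \<open>[DA, X]\<close>.\<close>

lemma INF_dist_le_dist_vcatification:
  assumes X: "obj X \<in> small_sets U" and A: "A \<in> small_sets U"
    and h: "h \<in> A \<rightarrow>\<^sub>E obj X" and k: "k \<in> A \<rightarrow>\<^sub>E obj X" and c: "c \<in> fo T A"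
  shows "(INF a\<in>A. dist X (h a) (k a)) \<le>
    dist (fo (vcatification U T) X) (fm T A (obj X) h c) (fm T A (obj X) k c)"
proof -
  let ?r = "INF a\<in>A. dist X (h a) (k a)"
  have "\<forall>a\<in>A. (h a, k a) \<in> rel (fo \<Phi> X) ?r" using h k by (auto intro: INF_lower)
  moreover have "rel (fo \<Phi> X) ?r \<subseteq> obj X \<times> obj X" by auto
  ultimately have "(fm T A (obj X) h c, fm T A (obj X) k c) \<in>
      rel_lift U T (obj X) (obj X) (rel (fo \<Phi> X) ?r)"
    using rel_lift_iff[OF X X] A h k c by blast
  then show ?thesis unfolding dist_vcatification by (intro Sup_upper) simp
qed

lemma dist_vcatification_le:
  assumes X: "obj X \<in> small_sets U"
    and le: "\<And>A h k c. \<lbrakk>A \<in> small_sets U; h \<in> A \<rightarrow>\<^sub>E obj X; k \<in> A \<rightarrow>\<^sub>E obj X; c \<in> fo T A;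
      s = fm T A (obj X) h c; t = fm T A (obj X) k c\<rbrakk> \<Longrightarrow> (INF a\<in>A. dist X (h a) (k a)) \<le> d"
  shows "dist (fo (vcatification U T) X) s t \<le> d"
  unfolding dist_vcatification
proof (rule Sup_least)
  fix r assume "r \<in> {r. (s, t) \<in> rel (fo (RelLift U T) (fo \<Phi> X)) r}"
  then have st: "(s, t) \<in> rel_lift U T (obj X) (obj X) (rel (fo \<Phi> X) r)" by simp
  have sub: "rel (fo \<Phi> X) r \<subseteq> obj X \<times> obj X" by auto
  from st obtain A h k c where *: "A \<in> small_sets U" "h \<in> A \<rightarrow>\<^sub>E obj X" "k \<in> A \<rightarrow>\<^sub>E obj X" "c \<in> fo T A"
    "s = fm T A (obj X) h c" "t = fm T A (obj X) k c" and hk: "\<forall>a\<in>A. (h a, k a) \<in> rel (fo \<Phi> X) r"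
    unfolding rel_lift_iff[OF X X sub] by blast
  have "r \<le> (INF a\<in>A. dist X (h a) (k a))" using hk by (auto intro: INF_greatest)
  also have "\<dots> \<le> d" by (rule le[OF *])
  finally show "r \<le> d" .
qed

text \<open>The presheaf axioms of the lifted relations give reflexivity and composition at single
  levels; \<open>tensor_Sup_le\<close> extends composition to the suprema.\<close>

lemma is_vcat_vcatification:
  assumes X: "is_vcat V X" "obj X \<in> small_sets U"
  shows "is_vcat V (fo (vcatification U T) X)"
proof -
  let ?R = "rel (fo (RelLift U T) (fo \<Phi> X))"
  have R: "is_rpresh V (fo (RelLift U T) (fo \<Phi> X))"
    using X by (intro is_rpresh_RelLift is_rpresh_\<Phi>) auto
  then have sub: "?R r \<subseteq> fo T (obj X) \<times> fo T (obj X)" for r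
    unfolding is_rpresh_def by fastforce
  show ?thesis
    unfolding is_vcat_def vcatification_simps
  proof (intro conjI ballI allI impI)
    fix t assume "t \<in> fo T (obj X)"
    then have "(t, t) \<in> ?R \<e>" using R unfolding is_rpresh_def by (auto simp del: RelLift_simps(2))
    then show "\<e> \<le> dist (fo (vcatification U T) X) t t"
      unfolding dist_vcatification by (intro Sup_upper) simp
  next
    fix t s u
    show "dist (fo (vcatification U T) X) s t \<otimes> dist (fo (vcatification U T) X) u s
        \<le> dist (fo (vcatification U T) X) u t"
      unfolding dist_vcatification
    proof (intro tensor_Sup_le Sup_upper CollectI)
      fix r r' assume "r \<in> {r. (s, t) \<in> ?R r}" "r' \<in> {r. (u, s) \<in> ?R r}"
      then have "(u, t) \<in> ?R r' O ?R r" by blast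
      then show "(u, t) \<in> ?R (r \<otimes> r')" using R unfolding is_rpresh_def by blast
    qed
  next
    fix t s assume "t \<notin> fo T (obj X) \<or> s \<notin> fo T (obj X)"
    then have "{r. (s, t) \<in> ?R r} = {}" using sub by blast
    then show "dist (fo (vcatification U T) X) s t = bot"
      unfolding dist_vcatification by (simp only: Sup_empty)
  qed
qed

text \<open>The levels relating a fixed pair form a downset since the lifted presheaf is antitone,
  so \<open>le_Sup_downset_iff\<close> identifies the supremum with the closure.\<close>

lemma \<Phi>_vcatification:
  "functor_eq (underlying (VCat V U)) (\<Phi> \<circ>\<^sub>F vcatification U T) (Closure \<circ>\<^sub>F RelLift U T \<circ>\<^sub>F \<Phi>)"
proof -
  have "rel (fo \<Phi> (fo (vcatification U T) X)) r = rel (fo Closure (fo (RelLift U T) (fo \<Phi> X))) r"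
    if X: "is_vcat V X" "obj X \<in> small_sets U" for X :: "('a, 'v) vcat" and r
  proof -
    let ?R = "rel (fo (RelLift U T) (fo \<Phi> X))"
    have "is_rpresh V (fo (RelLift U T) (fo \<Phi> X))"
      using X by (intro is_rpresh_RelLift is_rpresh_\<Phi>) auto
    then have "downset {r. (s, t) \<in> ?R r}" for s t
      unfolding downset_def is_rpresh_def by blast
    then show ?thesis
      by (auto simp: dist_vcatification le_Sup_downset_iff[OF cd] simp del: RelLift_simps(2))
  qed
  then show ?thesis
    by (auto simp: functor_eq_def rpresh_eq_iff underlying_def VCat_def
        simp del: \<Phi>_simps(2) Closure_simps(2) intro!: ext)
qed

text \<open>Composing the legs of a span with \<open>f\<close> does not decrease their distance, and
  the new span lifts to the image pair under \<open>T f\<close>.\<close>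

lemma is_vfunctor_vcatification:
  assumes X: "obj X \<in> small_sets U" and Y: "obj Y \<in> small_sets U" and f: "is_vfunctor X Y f"
  shows "is_vfunctor (fo (vcatification U T) X) (fo (vcatification U T) Y) (fm T (obj X) (obj Y) f)"
proof -
  have fXY: "f \<in> obj X \<rightarrow>\<^sub>E obj Y" using f by (simp add: is_vfunctor_def)
  have "dist (fo (vcatification U T) X) s t \<le>
    dist (fo (vcatification U T) Y) (fm T (obj X) (obj Y) f s) (fm T (obj X) (obj Y) f t)" for s t
  proof (rule dist_vcatification_le[OF X])
    fix A h k c
    assume A: "A \<in> small_sets U" and h: "h \<in> A \<rightarrow>\<^sub>E obj X" and k: "k \<in> A \<rightarrow>\<^sub>E obj X" and c: "c \<in> fo T A"
      and st: "s = fm T A (obj X) h c" "t = fm T A (obj X) k c"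
    have "(INF a\<in>A. dist X (h a) (k a)) \<le> (INF a\<in>A. dist Y (compose A f h a) (compose A f k a))"
      using f h k by (intro INF_superset_mono) (auto simp: is_vfunctor_def compose_def PiE_iff)
    also have "\<dots> \<le> dist (fo (vcatification U T) Y)
        (fm T A (obj Y) (compose A f h) c) (fm T A (obj Y) (compose A f k) c)"
      by (rule INF_dist_le_dist_vcatification[OF Y A compose_PiE[OF h fXY] compose_PiE[OF k fXY] c])
    finally show "(INF a\<in>A. dist X (h a) (k a)) \<le> dist (fo (vcatification U T) Y)
        (fm T (obj X) (obj Y) f s) (fm T (obj X) (obj Y) f t)"
      using st T_compose_apply[OF A X Y h fXY c] T_compose_apply[OF A X Y k fXY c] by simp
  qed
  then show ?thesis using T_PiE[OF X Y fXY] by (simp add: is_vfunctor_def)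
qed

lemma is_efunctor_vcatification: "is_efunctor (VCat V U) (VCat V U) (vcatification U T)"
proof -
  have "is_functor (underlying (VCat V U)) (underlying (VCat V U)) (vcatification U T)"
    unfolding is_functor_def underlying_def VCat_def
    by (auto simp: is_vcat_vcatification T_small T_id vhom_def is_vfunctor_vcatification
        intro!: T_compose) (auto simp: is_vfunctor_def)
  moreover have "is_vfunctor (vhom X Y) (vhom (fo (vcatification U T) X) (fo (vcatification U T) Y))
      (restrict (fm (vcatification U T) X Y) (obj (vhom X Y)))"
    if X: "obj X \<in> small_sets U" and Y: "obj Y \<in> small_sets U" for X Y :: "('a, 'v) vcat"
  proof -
    \<comment> \<open>Here \<open>f\<close> and \<open>g\<close> themselves form the span, with apex
      \<open>obj X\<close> and witness \<open>t\<close>.\<close>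
    have "(INF x\<in>obj X. dist Y (f x) (g x)) \<le> (INF t\<in>fo T (obj X). dist (fo (vcatification U T) Y)
        (fm T (obj X) (obj Y) f t) (fm T (obj X) (obj Y) g t))"
      if "is_vfunctor X Y f" "is_vfunctor X Y g" for f g
      using that by (intro INF_greatest INF_dist_le_dist_vcatification X Y) (auto simp: is_vfunctor_def)
    then show ?thesis
      using is_vfunctor_vcatification[OF X Y]
      by (auto simp: is_vfunctor_def[of "vhom X Y"]) (auto simp: vhom_def)
  qed
  ultimately show ?thesis unfolding is_efunctor_def by (simp add: VCat_def)
qed

section \<open>Discrete functors as enriched functors\<close>

text \<open>A general \<open>F\<close> covers both \<open>D\<close> and \<open>DT\<close>. As the
  homs of \<open>SetE\<close> are discrete, the enriched condition reduces to reflexivity of the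
  target homs.\<close>

lemma is_efunctor_Disc_comp:
  assumes F: "is_functor (Set_cat U) (Set_cat U) F"
  shows "is_efunctor (SetE V U) (VCat V U) (Disc V \<circ>\<^sub>F F)"
proof -
  note FD = is_functorD[OF F, unfolded Set_cat_def, simplified]
  have "is_functor (underlying (SetE V U)) (underlying (VCat V U)) (Disc V \<circ>\<^sub>F F)"
    unfolding is_functor_def underlying_def VCat_def SetE_def Disc_def Set_cat_def
    using FD by (simp add: is_vcat_discrete obj_vhom_discrete)
  moreover have "is_vfunctor (discrete V (A \<rightarrow>\<^sub>E B)) (vhom (discrete V (fo F A)) (discrete V (fo F B)))
      (restrict (fm F A B) (A \<rightarrow>\<^sub>E B))" if "A \<in> small_sets U" "B \<in> small_sets U" for A B
  proof -
    have "\<e> \<le> dist (vhom (discrete V (fo F A)) (discrete V (fo F B))) f f"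
      if f: "f \<in> fo F A \<rightarrow>\<^sub>E fo F B" for f
    proof -
      have "dist (vhom (discrete V (fo F A)) (discrete V (fo F B))) f f =
          (INF y\<in>fo F A. dist (discrete V (fo F B)) (f y) (f y))"
        using f by (intro dist_vhom_discrete is_vcat_discrete) auto
      also have "\<e> \<le> \<dots>"
        using f by (intro INF_greatest) (auto simp: discrete_def)
      finally show ?thesis .
    qed
    then show ?thesis
      using FD(2)[OF that]
      by (auto simp: is_vfunctor_def obj_vhom_discrete[OF is_vcat_discrete])
        (auto simp: discrete_def)
  qed
  ultimately show ?thesis
    unfolding is_efunctor_def
    by (simp add: VCat_def SetE_def Disc_def Set_cat_def functor_comp_def)
qed

lemma is_efunctor_Disc: "is_efunctor (SetE V U) (VCat V U) (Disc V)"
proof -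
  let ?I = "\<lparr>fo = \<lambda>A. A, fm = \<lambda>A B f. f\<rparr> :: 'a set_functor"
  have "is_functor (Set_cat U) (Set_cat U) ?I" by (simp add: is_functor_def)
  moreover have "Disc V \<circ>\<^sub>F ?I = Disc V" by (simp add: functor_comp_def Disc_def)
  ultimately show ?thesis using is_efunctor_Disc_comp[of ?I] by simp
qed

lemma compose_vfunctor_lift:
  assumes X: "obj X \<in> small_sets U" and A: "A \<in> small_sets U" and k: "k \<in> A \<rightarrow>\<^sub>E obj X"
    and g: "is_vfunctor (fo (vcatification U T) X) Y g"
  shows "compose (fo T A) g (fm T A (obj X) k) \<in> fo T A \<rightarrow>\<^sub>E obj Y"
  using g by (intro compose_PiE[OF T_PiE[OF A X k]]) (simp add: is_vfunctor_def)

section \<open>The universal property for fixed \<open>X\<close> and \<open>Y\<close>\<close>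

context
  fixes X Y :: "('a, 'v) vcat"
  assumes X: "is_vcat V X" "obj X \<in> small_sets U"
    and Y: "is_vcat V Y"
begin

lemma psh_trans_iff:
  "\<phi> \<in> psh_trans (SetE V U) (rep (VCat V U) (Disc V) X) (rep (VCat V U) (Disc V \<circ>\<^sub>F T) Y) \<longleftrightarrow>
    \<phi> \<in> extensional (small_sets U) \<and>
    (\<forall>A\<in>small_sets U. is_vfunctor (vhom (discrete V A) X) (vhom (discrete V (fo T A)) Y) (\<phi> A)) \<and>
    (\<forall>A\<in>small_sets U. \<forall>B\<in>small_sets U. \<forall>h\<in>A \<rightarrow>\<^sub>E B. \<forall>k\<in>B \<rightarrow>\<^sub>E obj X.
      \<phi> A (compose A k h) = compose (fo T A) (\<phi> B k) (fm T A B h))"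
proof -
  \<comment> \<open>The action of \<open>rep\<close> is restricted to objects of the hom; this
    membership allows its value at \<open>\<phi> B k\<close> to be unfolded to a composite.\<close>
  have "\<phi> B k \<in> fo T B \<rightarrow>\<^sub>E obj Y"
    if "is_vfunctor (vhom (discrete V B) X) (vhom (discrete V (fo T B)) Y) (\<phi> B)" "k \<in> B \<rightarrow>\<^sub>E obj X" for B k
    using that by (auto simp: is_vfunctor_def[of "vhom _ _"] obj_vhom_discrete X Y)
  then show ?thesis
    by (auto simp: psh_trans_def rep_def SetE_simps VCat_simps Disc_def PiE_iff
        obj_vhom[of "vhom _ _"] obj_vhom_discrete X Y)
qed

text \<open>The comparison map of the Kan extension for the identity unit. The restrictions make its
  values extensional, as membership in \<open>psh_trans\<close> requires.\<close>

definition kan_map :: "('a \<Rightarrow> 'a) \<Rightarrow> 'a set \<Rightarrow> ('a \<Rightarrow> 'a) \<Rightarrow> 'a \<Rightarrow> 'a" where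
  "kan_map g = (\<lambda>A\<in>small_sets U. \<lambda>k\<in>A \<rightarrow>\<^sub>E obj X. compose (fo T A) g (fm T A (obj X) k))"

lemma kan_map_apply:
  "A \<in> small_sets U \<Longrightarrow> k \<in> A \<rightarrow>\<^sub>E obj X \<Longrightarrow>
    kan_map g A k = compose (fo T A) g (fm T A (obj X) k)"
  by (simp add: kan_map_def)

lemma dist_kan_map:
  assumes g: "is_vfunctor (fo (vcatification U T) X) Y g"
    and g': "is_vfunctor (fo (vcatification U T) X) Y g'"
    and A: "A \<in> small_sets U" and k: "k \<in> A \<rightarrow>\<^sub>E obj X" and k': "k' \<in> A \<rightarrow>\<^sub>E obj X"
  shows "dist (vhom (discrete V (fo T A)) Y) (kan_map g A k) (kan_map g' A k') =
    (INF t\<in>fo T A. dist Y (g (fm T A (obj X) k t)) (g' (fm T A (obj X) k' t)))"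
  unfolding kan_map_apply[OF A k] kan_map_apply[OF A k']
  by (subst dist_vhom_discrete[OF Y compose_vfunctor_lift[OF X(2) A k g]
        compose_vfunctor_lift[OF X(2) A k' g']])
    (auto simp: compose_eq intro!: INF_cong)

text \<open>Naturality is functoriality of \<open>T\<close>. Each component is a V-functor because
  the distance from \<open>h\<close> to \<open>k\<close> is one of those bounding the distance on
  \<open>T X\<close> from below, and \<open>g\<close> does not decrease that.\<close>

lemma kan_map_psh_trans:
  assumes g: "is_vfunctor (fo (vcatification U T) X) Y g"
  shows "kan_map g \<in> psh_trans (SetE V U) (rep (VCat V U) (Disc V) X) (rep (VCat V U) (Disc V \<circ>\<^sub>F T) Y)"
  unfolding psh_trans_iff
proof (intro conjI ballI)
  show "kan_map g \<in> extensional (small_sets U)" by (simp add: kan_map_def)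
next
  fix A B h k
  assume A: "A \<in> small_sets U" and B: "B \<in> small_sets U" and h: "h \<in> A \<rightarrow>\<^sub>E B" and k: "k \<in> B \<rightarrow>\<^sub>E obj X"
  have "kan_map g A (compose A k h) t = compose (fo T A) (kan_map g B k) (fm T A B h) t" for t
  proof (cases "t \<in> fo T A")
    case True
    then show ?thesis
      using T_mem[OF A B h True] T_compose_apply[OF A B X(2) h k True]
      by (simp add: kan_map_apply[OF A compose_PiE[OF h k]] kan_map_apply[OF B k] compose_eq)
  next
    case False
    then show ?thesis
      unfolding kan_map_apply[OF A compose_PiE[OF h k]] by (simp add: compose_def)
  qed
  then show "kan_map g A (compose A k h) = compose (fo T A) (kan_map g B k) (fm T A B h)" ..
next
  fix A assume A: "A \<in> small_sets U"
  have "dist (vhom (discrete V A) X) h k \<le> dist (vhom (discrete V (fo T A)) Y) (kan_map g A h) (kan_map g A k)"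
    if h: "h \<in> A \<rightarrow>\<^sub>E obj X" and k: "k \<in> A \<rightarrow>\<^sub>E obj X" for h k
    unfolding dist_vhom_discrete[OF X(1) h k] dist_kan_map[OF g g A h k]
  proof (rule INF_greatest)
    fix t assume t: "t \<in> fo T A"
    have "(INF a\<in>A. dist X (h a) (k a)) \<le>
        dist (fo (vcatification U T) X) (fm T A (obj X) h t) (fm T A (obj X) k t)"
      by (rule INF_dist_le_dist_vcatification[OF X(2) A h k t])
    also have "\<dots> \<le> dist Y (g (fm T A (obj X) h t)) (g (fm T A (obj X) k t))"
      using g T_mem[OF A X(2) h t] T_mem[OF A X(2) k t] by (simp add: is_vfunctor_def)
    finally show "(INF a\<in>A. dist X (h a) (k a)) \<le>
        dist Y (g (fm T A (obj X) h t)) (g (fm T A (obj X) k t))" .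
  qed
  moreover have "kan_map g A \<in> (A \<rightarrow>\<^sub>E obj X) \<rightarrow>\<^sub>E (fo T A \<rightarrow>\<^sub>E obj Y)"
  proof (rule PiE_I)
    show "kan_map g A k \<in> fo T A \<rightarrow>\<^sub>E obj Y" if "k \<in> A \<rightarrow>\<^sub>E obj X" for k
      unfolding kan_map_apply[OF A that] by (rule compose_vfunctor_lift[OF X(2) A that g])
    show "kan_map g A k = undefined" if "k \<notin> A \<rightarrow>\<^sub>E obj X" for k
      using that A by (simp add: kan_map_def)
  qed
  ultimately show "is_vfunctor (vhom (discrete V A) X) (vhom (discrete V (fo T A)) Y) (kan_map g A)"
    unfolding is_vfunctor_def[of "vhom _ _"] obj_vhom_discrete[OF X(1)] obj_vhom_discrete[OF Y] by blast
qed

text \<open>One half of bijectivity: \<open>T\<close> preserves the identity, so evaluation there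
  recovers \<open>g\<close>.\<close>

lemma kan_map_id:
  assumes g: "is_vfunctor (fo (vcatification U T) X) Y g"
  shows "kan_map g (obj X) (\<lambda>x\<in>obj X. x) = g"
  using g by (subst kan_map_apply)
    (auto simp: X T_id is_vfunctor_def intro!: compose_id_right)

text \<open>By the Yoneda lemma a transformation is determined by its value at the identity on the set
  of objects of \<open>X\<close>.\<close>

lemma psh_trans_is_kan_map:
  assumes \<phi>: "\<phi> \<in> psh_trans (SetE V U) (rep (VCat V U) (Disc V) X) (rep (VCat V U) (Disc V \<circ>\<^sub>F T) Y)"
  defines "g \<equiv> \<phi> (obj X) (\<lambda>x\<in>obj X. x)"
  shows "is_vfunctor (fo (vcatification U T) X) Y g" and "kan_map g = \<phi>"
proof -
  have extensional: "\<phi> \<in> extensional (small_sets U)"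
    and vf: "\<And>A. A \<in> small_sets U \<Longrightarrow>
      is_vfunctor (vhom (discrete V A) X) (vhom (discrete V (fo T A)) Y) (\<phi> A)"
    and nat: "\<And>A B h k. \<lbrakk>A \<in> small_sets U; B \<in> small_sets U; h \<in> A \<rightarrow>\<^sub>E B; k \<in> B \<rightarrow>\<^sub>E obj X\<rbrakk> \<Longrightarrow>
      \<phi> A (compose A k h) = compose (fo T A) (\<phi> B k) (fm T A B h)"
    using \<phi> unfolding psh_trans_iff by blast+
  have id: "(\<lambda>x\<in>obj X. x) \<in> obj X \<rightarrow>\<^sub>E obj X" by auto
  have \<phi>_mem: "\<phi> A \<in> (A \<rightarrow>\<^sub>E obj X) \<rightarrow>\<^sub>E (fo T A \<rightarrow>\<^sub>E obj Y)" if "A \<in> small_sets U" for A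
    using vf[OF that] unfolding is_vfunctor_def[of "vhom _ _"] obj_vhom_discrete[OF X(1)]
      obj_vhom_discrete[OF Y] by blast
  have gXY: "g \<in> fo T (obj X) \<rightarrow>\<^sub>E obj Y"
    unfolding g_def using PiE_mem[OF \<phi>_mem[OF X(2)] id] .
  \<comment> \<open>Naturality along \<open>k\<close> itself, applied to the identity on
    \<open>obj X\<close>, since \<open>k\<close> is the composite of the two.\<close>
  have \<phi>_eq: "\<phi> A k = compose (fo T A) g (fm T A (obj X) k)"
    if "A \<in> small_sets U" "k \<in> A \<rightarrow>\<^sub>E obj X" for A k
    using nat[OF that(1) X(2) that(2) id] by (simp add: compose_id_left[OF that(2)] g_def)
  show "kan_map g = \<phi>"
  proof (rule ext, rule ext)
    show "kan_map g A k = \<phi> A k" for A k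
    proof (cases "A \<in> small_sets U")
      case True
      then show ?thesis
        using PiE_arb[OF \<phi>_mem[OF True], of k] by (simp add: kan_map_def \<phi>_eq)
    next
      case False
      then show ?thesis using extensional_arb[OF extensional False] by (simp add: kan_map_def)
    qed
  qed
  \<comment> \<open>The distance is a supremum over spans, so one span at a time suffices:
    V-functoriality of \<open>\<phi> A\<close> bounds it by an infimum over \<open>fo T A\<close>,
    which is then evaluated at the witness \<open>c\<close>.\<close>
  have "dist (fo (vcatification U T) X) s t \<le> dist Y (g s) (g t)" for s t
  proof (rule dist_vcatification_le[OF X(2)])
    fix A h k c
    assume A: "A \<in> small_sets U" and h: "h \<in> A \<rightarrow>\<^sub>E obj X" and k: "k \<in> A \<rightarrow>\<^sub>E obj X" and c: "c \<in> fo T A"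
      and st: "s = fm T A (obj X) h c" "t = fm T A (obj X) k c"
    have "(INF a\<in>A. dist X (h a) (k a)) = dist (vhom (discrete V A) X) h k"
      by (rule dist_vhom_discrete[OF X(1) h k, symmetric])
    also have "\<dots> \<le> dist (vhom (discrete V (fo T A)) Y) (\<phi> A h) (\<phi> A k)"
      using vf[OF A] h k unfolding is_vfunctor_def[of "vhom _ _"] obj_vhom_discrete[OF X(1)] by blast
    also have "\<dots> = (INF t\<in>fo T A. dist Y (\<phi> A h t) (\<phi> A k t))"
      using PiE_mem[OF \<phi>_mem[OF A] h] PiE_mem[OF \<phi>_mem[OF A] k] by (rule dist_vhom_discrete[OF Y])
    also have "\<dots> \<le> dist Y (\<phi> A h c) (\<phi> A k c)" using c by (rule INF_lower)
    also have "\<dots> = dist Y (g s) (g t)"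
      using c by (simp add: \<phi>_eq[OF A h] \<phi>_eq[OF A k] compose_eq st)
    finally show "(INF a\<in>A. dist X (h a) (k a)) \<le> dist Y (g s) (g t)" .
  qed
  then show "is_vfunctor (fo (vcatification U T) X) Y g"
    using gXY by (simp add: is_vfunctor_def)
qed

text \<open>The end is an infimum over all \<open>A\<close>, \<open>k\<close> and \<open>t\<close>
  of distances at the points \<open>T k t\<close> of \<open>T X\<close>. Taking the identity for
  \<open>k\<close> reaches every point, so it equals the infimum over \<open>T X\<close>.\<close>

lemma dist_psh_hom_kan_map:
  assumes g: "is_vfunctor (fo (vcatification U T) X) Y g"
    and g': "is_vfunctor (fo (vcatification U T) X) Y g'"
  shows "dist (psh_hom (SetE V U) (rep (VCat V U) (Disc V) X) (rep (VCat V U) (Disc V \<circ>\<^sub>F T) Y))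
      (kan_map g) (kan_map g') = dist (vhom (fo (vcatification U T) X) Y) g g'"
proof -
  have vf: "is_vfunctor (vhom (discrete V A) X) (vhom (discrete V (fo T A)) Y) (kan_map f A)"
    if "A \<in> small_sets U" "is_vfunctor (fo (vcatification U T) X) Y f" for A f
    using kan_map_psh_trans[OF that(2)] that(1) unfolding psh_trans_iff by blast
  have "dist (psh_hom (SetE V U) (rep (VCat V U) (Disc V) X) (rep (VCat V U) (Disc V \<circ>\<^sub>F T) Y))
      (kan_map g) (kan_map g') =
    (INF A\<in>small_sets U. dist (vhom (vhom (discrete V A) X) (vhom (discrete V (fo T A)) Y))
      (kan_map g A) (kan_map g' A))"
    using kan_map_psh_trans[OF g] kan_map_psh_trans[OF g']
    by (simp add: psh_hom_def rep_def SetE_simps VCat_simps Disc_def)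
  also have "\<dots> = (INF A\<in>small_sets U. INF k\<in>A \<rightarrow>\<^sub>E obj X.
      dist (vhom (discrete V (fo T A)) Y) (kan_map g A k) (kan_map g' A k))"
    by (intro INF_cong refl)
      (subst vhom_def, simp add: vf g g' obj_vhom_discrete[OF X(1)])
  also have "\<dots> = (INF A\<in>small_sets U. INF k\<in>A \<rightarrow>\<^sub>E obj X. INF t\<in>fo T A.
      dist Y (g (fm T A (obj X) k t)) (g' (fm T A (obj X) k t)))"
    by (intro INF_cong refl) (rule dist_kan_map[OF g g'])
  also have "\<dots> = (INF t\<in>fo T (obj X). dist Y (g t) (g' t))" (is "?L = ?R")
  proof (rule antisym)
    have "?L \<le> dist Y (g t) (g' t)" if t: "t \<in> fo T (obj X)" for t
    proof -
      have id: "(\<lambda>x\<in>obj X. x) \<in> obj X \<rightarrow>\<^sub>E obj X" by auto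
      show ?thesis
        using t by (intro INF_lower2[OF X(2)] INF_lower2[OF id] INF_lower2[OF t])
          (simp add: T_id[OF X(2)])
    qed
    then show "?L \<le> ?R" by (rule INF_greatest)
    show "?R \<le> ?L"
      by (intro INF_greatest INF_lower T_mem[OF _ X(2)])
  qed
  also have "\<dots> = dist (vhom (fo (vcatification U T) X) Y) g g'"
    using g g' by (simp add: vhom_def)
  finally show ?thesis .
qed

lemma is_viso_kan_map:
  "is_viso (vhom (fo (vcatification U T) X) Y)
     (psh_hom (SetE V U) (rep (VCat V U) (Disc V) X) (rep (VCat V U) (Disc V \<circ>\<^sub>F T) Y)) kan_map"
  unfolding is_viso_def obj_vhom
proof (intro conjI ballI)
  show "bij_betw kan_map {g. is_vfunctor (fo (vcatification U T) X) Y g}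
      (obj (psh_hom (SetE V U) (rep (VCat V U) (Disc V) X) (rep (VCat V U) (Disc V \<circ>\<^sub>F T) Y)))"
    \<comment> \<open>The inverse is the Yoneda evaluation at the identity.\<close>
    by (rule bij_betw_byWitness[where f' = "\<lambda>\<phi>. \<phi> (obj X) (\<lambda>x\<in>obj X. x)"])
      (auto simp: psh_hom_def kan_map_id psh_trans_is_kan_map kan_map_psh_trans)
qed (simp add: dist_psh_hom_kan_map)

end

text \<open>\<open>DT A\<close> and the extension at \<open>DA\<close> have the same underlying set,
  and the former is discrete, so identity functions serve as the unit. The universal property then
  reduces to \<open>is_viso_kan_map\<close>.\<close>

lemma is_left_kan_ext_vcatification:
  "is_left_kan_ext (SetE V U) (VCat V U) (VCat V U) (Disc V) (Disc V \<circ>\<^sub>F T)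
     (vcatification U T) (\<lambda>A. \<lambda>t\<in>fo T A. t)"
  unfolding is_left_kan_ext_def
proof (intro conjI ballI)
  show "is_efunctor (SetE V U) (VCat V U) (Disc V)" by (rule is_efunctor_Disc)
  show "is_efunctor (SetE V U) (VCat V U) (Disc V \<circ>\<^sub>F T)" by (rule is_efunctor_Disc_comp[OF T_functor])
  show "is_efunctor (VCat V U) (VCat V U) (vcatification U T)" by (rule is_efunctor_vcatification)
  show "nat_trans (underlying (SetE V U)) (underlying (VCat V U)) (Disc V \<circ>\<^sub>F T)
      (vcatification U T \<circ>\<^sub>F Disc V) (\<lambda>A. \<lambda>t\<in>fo T A. t)"
    unfolding nat_trans_def
  proof (intro conjI ballI)
    fix A assume "A \<in> Ob (underlying (SetE V U))"
    then have "is_vcat V (fo (vcatification U T) (discrete V A))"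
      by (simp add: underlying_def SetE_simps is_vcat_vcatification is_vcat_discrete)
    then show "(\<lambda>t\<in>fo T A. t) \<in> Mor (underlying (VCat V U)) (fo (Disc V \<circ>\<^sub>F T) A)
        (fo (vcatification U T \<circ>\<^sub>F Disc V) A)"
      by (simp add: underlying_def VCat_simps Disc_def obj_vhom_discrete)
  next
    fix A B f
    assume "A \<in> Ob (underlying (SetE V U))" "B \<in> Ob (underlying (SetE V U))"
      "f \<in> Mor (underlying (SetE V U)) A B"
    then have "fm T A B f \<in> fo T A \<rightarrow>\<^sub>E fo T B"
      by (intro T_PiE) (simp_all add: underlying_def SetE_simps)
    then show "Cmp (underlying (VCat V U)) (fo (Disc V \<circ>\<^sub>F T) A) (fo (Disc V \<circ>\<^sub>F T) B)
        (fo (vcatification U T \<circ>\<^sub>F Disc V) B) (\<lambda>t\<in>fo T B. t) (fm (Disc V \<circ>\<^sub>F T) A B f) =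
      Cmp (underlying (VCat V U)) (fo (Disc V \<circ>\<^sub>F T) A) (fo (vcatification U T \<circ>\<^sub>F Disc V) A)
        (fo (vcatification U T \<circ>\<^sub>F Disc V) B) (fm (vcatification U T \<circ>\<^sub>F Disc V) A B f) (\<lambda>t\<in>fo T A. t)"
      by (simp add: underlying_def VCat_simps Disc_def compose_id_left compose_id_right)
  qed
next
  fix X Y :: "('a, 'v) vcat"
  assume "X \<in> EOb (VCat V U)" "Y \<in> EOb (VCat V U)"
  then have X: "is_vcat V X" "obj X \<in> small_sets U" and Y: "is_vcat V Y"
    by (auto simp: VCat_simps)
  \<comment> \<open>Composition with the identity unit cancels, which turns the comparison map into
    \<open>kan_map X\<close>.\<close>
  have "(\<lambda>g. \<lambda>A\<in>EOb (SetE V U). \<lambda>k\<in>obj (EHom (VCat V U) (fo (Disc V) A) X).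
      ECmp (VCat V U) (fo (Disc V \<circ>\<^sub>F T) A) (fo (vcatification U T) X) Y g
        (ECmp (VCat V U) (fo (Disc V \<circ>\<^sub>F T) A) (fo (vcatification U T) (fo (Disc V) A))
          (fo (vcatification U T) X) (fm (vcatification U T) (fo (Disc V) A) X k) (\<lambda>t\<in>fo T A. t))) =
    kan_map X"
    unfolding kan_map_def[OF X Y]
    by (simp add: SetE_simps VCat_simps Disc_def obj_vhom_discrete[OF X(1)]
        compose_id_right[OF T_PiE[OF _ X(2)]] cong: restrict_cong)
  then show "is_viso (EHom (VCat V U) (fo (vcatification U T) X) Y)
      (psh_hom (SetE V U) (rep (VCat V U) (Disc V) X) (rep (VCat V U) (Disc V \<circ>\<^sub>F T) Y))
      (\<lambda>g. \<lambda>A\<in>EOb (SetE V U). \<lambda>k\<in>obj (EHom (VCat V U) (fo (Disc V) A) X).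
        ECmp (VCat V U) (fo (Disc V \<circ>\<^sub>F T) A) (fo (vcatification U T) X) Y g
          (ECmp (VCat V U) (fo (Disc V \<circ>\<^sub>F T) A) (fo (vcatification U T) (fo (Disc V) A))
            (fo (vcatification U T) X) (fm (vcatification U T) (fo (Disc V) A) X k) (\<lambda>t\<in>fo T A. t)))"
    using is_viso_kan_map[OF X Y] by (simp add: VCat_simps)
qed

end

theorem theorem3p40:
  fixes V :: "'v::complete_lattice quantale"
    and U :: "'a universe"
    and T :: "'a set_functor"
  assumes "set_universe U"
    and "comm_quantale V"
    and "completely_distributive TYPE('v)"
    and "tensor_laxly_preserves_totally_below V"
    and "is_functor (Set_cat U) (Set_cat U) T"
    and "preserves_weak_pullbacks (Set_cat U) (Set_cat U) T"
  shows "is_functor (RelPresh\<^sub>c V U) (RelPresh V U) (RelLift U T)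
    \<and> functor_eq (Set_cat U) (Closure \<circ>\<^sub>F DiscR V) (DiscR V)
    \<and> (functor_eq (Set_cat U) (RelLift U T \<circ>\<^sub>F DiscR V) (DiscR V \<circ>\<^sub>F T) \<longleftrightarrow>
         (\<forall>x. \<forall>s\<in>fo T {x}. \<forall>t\<in>fo T {x}. s = t) \<and> (\<e>\<^bsub>V\<^esub> = top \<or> fo T {} = {}))
    \<and> (functor_eq (Set_cat U) (Closure \<circ>\<^sub>F RelLift U T \<circ>\<^sub>F DiscR V) (DiscR V \<circ>\<^sub>F T) \<longleftrightarrow>
         \<e>\<^bsub>V\<^esub> = top \<or> fo T {} = {})
    \<and> (\<exists>T\<^sub>V \<alpha>. is_left_kan_ext (SetE V U) (VCat V U) (VCat V U) (Disc V) (Disc V \<circ>\<^sub>F T) T\<^sub>V \<alpha>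
         \<and> functor_eq (underlying (VCat V U)) (\<Phi> \<circ>\<^sub>F T\<^sub>V) (Closure \<circ>\<^sub>F RelLift U T \<circ>\<^sub>F \<Phi>))"
proof -
  interpret set_universe U by fact
  interpret comm_quantale V by fact
  interpret quantale_set_functor U T V by unfold_locales fact+
  \<comment> \<open>The Kan extension is \<open>vcatification U T\<close>, with identity functions
    as its unit.\<close>
  show ?thesis
    using is_functor_RelLift Closure_DiscR RelLift_DiscR_iff Closure_RelLift_DiscR_iff
      is_left_kan_ext_vcatification \<Phi>_vcatification
    by (intro conjI exI)
qed

end
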